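(* Let $H$ be a fixed graph with no isolated vertices, and let $n$ be even. Then \[ \lim_{n\to\infty}\Pr{G(H,n,p)\text{ has a perfect matching}}=\begin{cases}0 & p\le p_1^-(H),\\ 1 & p\ge p_1^+(H).\end{cases} \]
   Context: A copy of $H$ in $K_n$ is a subgraph of the complete graph on $[n]$ isomorphic to $H$. $G(H,n,p)$ is the random (multi)graph on $[n]$ obtained by including each copy of $H$ in $K_n$ independently with probability $p$ and taking the union. Let $m_1(H)$ be the number of copies of $H$ in $K_n$ containing the vertex $1$. Let $\delta(H)$ be the minimum degree of $H$, and for an integer $d\ge 0$ let $\delta_d(H)=\lceil d/\delta(H)\rceil-1$ and $p_d^{\pm}(H)=\frac{\ln n+\delta_d(H)\ln\ln n\pm x(n)}{m_1(H)}$, where $x(n)$ is any function with $1\ll x(n)\ll\ln\ln n$. *)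

theory Defs
  imports "HOL-Probability.Product_PMF" "HOL-Library.Landau_Symbols"
begin

type_synonym 'a ugraph = "'a set \<times> 'a set set"

abbreviation verts :: "'a ugraph \<Rightarrow> 'a set" where
  "verts G \<equiv> fst G"

abbreviation edges :: "'a ugraph \<Rightarrow> 'a set set" where
  "edges G \<equiv> snd G"

definition simple_graph :: "'a ugraph \<Rightarrow> bool" where
  "simple_graph G \<longleftrightarrow>
     finite (verts G) \<and> (\<forall>e\<in>edges G. e \<subseteq> verts G \<and> card e = 2)"

definition vertex_degree :: "'a ugraph \<Rightarrow> 'a \<Rightarrow> nat" where
  "vertex_degree G v = card {e \<in> edges G. v \<in> e}"

definition min_degree :: "'a ugraph \<Rightarrow> nat" where
  "min_degree G = Min (vertex_degree G ` verts G)"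

definition no_isolated_vertices :: "'a ugraph \<Rightarrow> bool" where
  "no_isolated_vertices G \<longleftrightarrow> (\<forall>v\<in>verts G. \<exists>e\<in>edges G. v \<in> e)"

definition graph_isomorphic :: "'a ugraph \<Rightarrow> 'b ugraph \<Rightarrow> bool" where
  "graph_isomorphic G H \<longleftrightarrow>
     (\<exists>f. bij_betw f (verts G) (verts H) \<and>
          (\<forall>u\<in>verts G. \<forall>v\<in>verts G. {u, v} \<in> edges G \<longleftrightarrow> {f u, f v} \<in> edges H))"

definition subgraph :: "'a ugraph \<Rightarrow> 'a ugraph \<Rightarrow> bool" where
  "subgraph G H \<longleftrightarrow> simple_graph G \<and> verts G \<subseteq> verts H \<and> edges G \<subseteq> edges H"

definition complete_graph :: "nat \<Rightarrow> nat ugraph" where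
  "complete_graph n = ({1..n}, {e. e \<subseteq> {1..n} \<and> card e = 2})"

definition copies :: "'a ugraph \<Rightarrow> nat \<Rightarrow> nat ugraph set" where
  "copies H n = {C. subgraph C (complete_graph n) \<and> graph_isomorphic H C}"

lemma finite_copies: "finite (copies H n)"
proof (rule finite_subset)
  show "copies H n \<subseteq> Pow {1..n} \<times> Pow (Pow {1..n})"
    by (fastforce simp: copies_def subgraph_def complete_graph_def)
qed simp

definition m1 :: "'a ugraph \<Rightarrow> nat \<Rightarrow> nat" where
  "m1 H n = card {C \<in> copies H n. 1 \<in> verts C}"

(* Edge multiplicities of the union are forgotten: they do not affect matchings. *)
definition random_copies_graph :: "'a ugraph \<Rightarrow> nat \<Rightarrow> real \<Rightarrow> nat ugraph pmf" where
  "random_copies_graph H n p =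
     map_pmf (\<lambda>included. ({1..n}, \<Union>C\<in>{C \<in> copies H n. included C}. edges C))
       (Pi_pmf (copies H n) False (\<lambda>_. bernoulli_pmf p))"

definition perfect_matching :: "'a ugraph \<Rightarrow> 'a set set \<Rightarrow> bool" where
  "perfect_matching G M \<longleftrightarrow> M \<subseteq> edges G \<and> (\<forall>v\<in>verts G. \<exists>!e. e \<in> M \<and> v \<in> e)"

definition has_perfect_matching :: "'a ugraph \<Rightarrow> bool" where
  "has_perfect_matching G \<longleftrightarrow> (\<exists>M. perfect_matching G M)"

definition delta :: "nat \<Rightarrow> 'a ugraph \<Rightarrow> int" where
  "delta d H = \<lceil>real d / real (min_degree H)\<rceil> - 1"

definition p_minus :: "nat \<Rightarrow> 'a ugraph \<Rightarrow> (nat \<Rightarrow> real) \<Rightarrow> nat \<Rightarrow> real" where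
  "p_minus d H x n =
     (ln (real n) + real_of_int (delta d H) * ln (ln (real n)) - x n) / real (m1 H n)"

definition p_plus :: "nat \<Rightarrow> 'a ugraph \<Rightarrow> (nat \<Rightarrow> real) \<Rightarrow> nat \<Rightarrow> real" where
  "p_plus d H x n =
     (ln (real n) + real_of_int (delta d H) * ln (ln (real n)) + x n) / real (m1 H n)"

(* The filter for limits as n tends to infinity through the even numbers. *)
definition even_at_top :: "nat filter" where
  "even_at_top = inf sequentially (principal {n. even n})"

end

theory Submission
  imports Defs "HOL-Real_Asymp.Real_Asymp"
begin

text \<open>
  Below the threshold, Chebyshev's inequality yields a vertex in no included copy: a vertex is
  isolated with probability \<open>(1 - p)\<^sup>m\<close>, where \<open>m = m1 H n\<close>, and two vertices share only
  \<open>O(m / n)\<close> copies, so the isolation events are almost independent.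

  Above the threshold, \<open>p\<close> may be decreased to \<open>p_plus\<close> by monotonicity. A graph of even order has a
  perfect matching if no set of at most linear size has fewer neighbours than elements and any two
  disjoint linear-sized sets are joined by an edge: if a maximum matching misses \<open>v\<close>, rotations give
  a set \<open>S\<close> of vertices that can be missed together with \<open>v\<close> and that satisfies \<open>|N(S)| < |S|\<close>,
  so \<open>S\<close> has linear size; by Gallai's lemma this produces two large sets without an edge between them.
  Sets of size above \<open>n\<^sup>0\<^sup>.\<^sup>6\<close> expand by a union bound over \<open>S\<close> and its neighbourhood. A smaller set is
  split into vertices in few included copies, which are non-isolated and far apart, and the others,
  which expand by a factor of four since small sets meet few copies twice.
\<close>

section \<open>Maximum matchings in expanders\<close>

text \<open>Copies are independent while the edges inside one copy are not, so every random event is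
  phrased through included copies. The union bound over pairs \<open>S\<close>, \<open>T\<close> of
  size \<open>s\<close> has at most (e n / s)^(2 s) cases, each failing with probability roughly
  n^(-s), and therefore succeeds only for \<open>s\<close> well above the square root of
  \<open>n\<close>. What rescues the argument is that the matching criterion asks only for |N(S)|
  \<ge> |S|, which a vertex with a single private neighbour meets, and that these exceptional
  vertices are too rare to lie close together. Linear-sized sets need a single edge between them
  instead of expansion. One count, the number \<open>m2\<close> of copies through two given
  vertices, of order \<open>h * m / n\<close>, controls both the weak dependence between vertices
  and the local sparsity.\<close>

definition is_matching :: "'a set set \<Rightarrow> 'a set set \<Rightarrow> bool" where
  "is_matching E M \<longleftrightarrow> M \<subseteq> E \<and> (\<forall>e\<in>M. \<forall>f\<in>M. e \<noteq> f \<longrightarrow> e \<inter> f = {})"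

definition max_matching :: "'a set set \<Rightarrow> 'a set set \<Rightarrow> bool" where
  "max_matching E M \<longleftrightarrow> is_matching E M \<and> (\<forall>M'. is_matching E M' \<longrightarrow> card M' \<le> card M)"

definition neighbours :: "'a set set \<Rightarrow> 'a set \<Rightarrow> 'a set" where
  "neighbours E S = {y. y \<notin> S \<and> (\<exists>x\<in>S. {x, y} \<in> E)}"

lemma is_matching_subset: "is_matching E M \<Longrightarrow> e \<in> M \<Longrightarrow> e \<in> E"
  unfolding is_matching_def by blast

lemma is_matching_eq: "is_matching E M \<Longrightarrow> e \<in> M \<Longrightarrow> f \<in> M \<Longrightarrow> x \<in> e \<Longrightarrow> x \<in> f \<Longrightarrow> e = f"
  unfolding is_matching_def by blast

lemma is_matchingI:
  assumes "M \<subseteq> E" "\<And>e f x. e \<in> M \<Longrightarrow> f \<in> M \<Longrightarrow> x \<in> e \<Longrightarrow> x \<in> f \<Longrightarrow> e = f"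
  shows "is_matching E M"
  unfolding is_matching_def using assms by blast

lemma is_matching_mono:
  assumes "is_matching E M" "M \<subseteq> E'"
  shows "is_matching E' M"
  using assms unfolding is_matching_def by blast

lemma max_matchingD: "max_matching E M \<Longrightarrow> is_matching E M"
  by (simp add: max_matching_def)

lemma max_matchingI:
  assumes "max_matching E M" "is_matching E M'" "card M' = card M"
  shows "max_matching E M'"
  using assms by (simp add: max_matching_def)

lemma max_matching_exists:
  assumes "finite E"
  obtains M where "max_matching E M"
proof -
  have "\<exists>M. is_matching E M \<and> (\<forall>M'. is_matching E M' \<longrightarrow> card M' \<le> card M)"
  proof (rule ex_has_greatest_nat[where k = "{}" and b = "Suc (card E)"])
    show "is_matching E {}" by (simp add: is_matching_def)
    show "\<forall>M. is_matching E M \<longrightarrow> card M < Suc (card E)"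
      using assms by (auto simp: is_matching_def less_Suc_eq_le intro: card_mono)
  qed
  then show ?thesis using that unfolding max_matching_def by blast
qed

lemma is_matching_insert:
  assumes "is_matching E M" "e \<in> E" "e \<inter> \<Union>M = {}"
  shows "is_matching E (insert e M)"
proof (rule is_matchingI)
  show "insert e M \<subseteq> E" using assms is_matching_subset by blast
  show "f = g" if "f \<in> insert e M" "g \<in> insert e M" "x \<in> f" "x \<in> g" for f g x
    using that assms is_matching_eq[OF assms(1), of f g x] by blast
qed

lemma is_matching_diff: "is_matching E M \<Longrightarrow> is_matching E (M - N)"
  unfolding is_matching_def by blast

lemma Union_matching_diff:
  assumes "is_matching E M" "e \<in> M"
  shows "\<Union>(M - {e}) = \<Union>M - e"
proof -
  have "f \<inter> e = {}" if "f \<in> M - {e}" for f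
    using assms that unfolding is_matching_def by auto
  then show ?thesis by auto
qed

locale finite_edges =
  fixes E :: "'a set set"
  assumes finite_E: "finite E" and card_E: "\<And>e. e \<in> E \<Longrightarrow> card e = 2"
begin

lemma finite_matching: "is_matching E M \<Longrightarrow> finite M"
  using finite_E finite_subset unfolding is_matching_def by blast

lemma edge_distinct: "{x, y} \<in> E \<Longrightarrow> x \<noteq> y"
  using card_E[of "{x, y}"] by auto

lemma matching_edge:
  assumes "is_matching E M" "x \<in> \<Union>M"
  obtains y where "{x, y} \<in> M" "y \<noteq> x"
proof -
  from assms obtain e where e: "e \<in> M" "x \<in> e" by blast
  then have "card e = 2" using assms card_E unfolding is_matching_def by blast
  then obtain y where "e = {x, y}" "y \<noteq> x"
    using e(2) by (auto simp: card_2_iff)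
  then show ?thesis using e that by blast
qed

lemma matching_edge_unique:
  assumes "is_matching E M" "{x, y} \<in> M" "{x, z} \<in> M"
  shows "y = z"
proof -
  have "{x, y} = {x, z}" using is_matching_eq[OF assms, of x] by simp
  then show ?thesis by (auto simp: doubleton_eq_iff)
qed

lemma max_matching_no_edge:
  assumes "max_matching E M" "u \<notin> \<Union>M" "w \<notin> \<Union>M"
  shows "{u, w} \<notin> E"
proof
  assume "{u, w} \<in> E"
  then have "is_matching E (insert {u, w} M)"
    using assms by (intro is_matching_insert) (auto simp: max_matching_def)
  moreover have "{u, w} \<notin> M" using assms by blast
  moreover have "finite M" using finite_matching[OF max_matchingD[OF assms(1)]] .
  moreover have "card (insert {u, w} M) \<le> card M"
    using calculation(1) assms(1) unfolding max_matching_def by blast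
  ultimately show False by simp
qed

text \<open>An alternating path with two edges: the exposed vertex moves from \<open>w\<close> to
  \<open>y\<close> and the size is unchanged.\<close>

lemma rotate:
  assumes M: "max_matching E M" and xy: "{x, y} \<in> M" and w: "w \<notin> \<Union>M" and wx: "{w, x} \<in> E"
  defines "M' \<equiv> insert {w, x} (M - {{x, y}})"
  shows "max_matching E M'" and "\<Union>M' = insert w (\<Union>M - {y})" and "y \<noteq> w"
proof -
  have mM: "is_matching E M" and fM: "finite M"
    using finite_matching max_matchingD[OF M] by auto
  have xyE: "{x, y} \<in> E" using is_matching_subset[OF mM xy] .
  have neq: "x \<noteq> y" "w \<noteq> x" using edge_distinct xyE wx by auto
  have U: "\<Union>(M - {{x, y}}) = \<Union>M - {x, y}" using Union_matching_diff[OF mM xy] .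
  show "\<Union>M' = insert w (\<Union>M - {y})"
    unfolding M'_def Union_insert U using xy neq by blast
  have "is_matching E M'" unfolding M'_def
    by (rule is_matching_insert) (use mM wx U w in \<open>auto intro: is_matching_diff\<close>)
  moreover have "card M' = card M"
  proof -
    have "{w, x} \<notin> M - {{x, y}}" using w by blast
    then have "card M' = Suc (card (M - {{x, y}}))" unfolding M'_def using fM by simp
    also have "\<dots> = card M" using xy fM by (metis card_Suc_Diff1)
    finally show ?thesis .
  qed
  ultimately show "max_matching E M'" using M max_matchingI by blast
  show "y \<noteq> w" using xy w by blast
qed

end

text \<open>From \<open>v\<close> follow an \<open>M1\<close>-edge to \<open>a\<close> and an
  \<open>M2\<close>-edge to \<open>b\<close>. If \<open>M1\<close> exposes \<open>b\<close>, one
  rotation frees \<open>v\<close> and covers at most one of \<open>u\<close> and \<open>w\<close>.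
  Otherwise delete \<open>v\<close> and \<open>a\<close> and continue from \<open>b\<close>; this is
  why the induction also generalises the edge set.\<close>

lemma gallai_exchange:
  assumes "finite_edges E" "max_matching E M1" "max_matching E M2"
    and "u \<noteq> w" "u \<notin> \<Union>M1" "w \<notin> \<Union>M1" "v \<notin> \<Union>M2" "v \<noteq> u" "v \<noteq> w"
  shows "\<exists>M. max_matching E M \<and> v \<notin> \<Union>M \<and> (u \<notin> \<Union>M \<or> w \<notin> \<Union>M)"
  using assms
proof (induction "card M1" arbitrary: E M1 M2 v rule: less_induct)
  case less
  interpret finite_edges E by fact
  note M1 = less.prems(2) and M2 = less.prems(3)
  have mM1: "is_matching E M1" and mM2: "is_matching E M2" using M1 M2 max_matchingD by auto
  have fM1: "finite M1" and fM2: "finite M2" using finite_matching mM1 mM2 by auto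
  have card_eq: "card M1 = card M2"
    using M1 M2 unfolding max_matching_def by (simp add: le_antisym)
  show ?case
  proof (cases "v \<in> \<Union>M1")
    case False
    then show ?thesis using less.prems by blast
  next
    case True
    then obtain a where va: "{v, a} \<in> M1" "a \<noteq> v" using matching_edge[OF mM1] by blast
    then have vaE: "{v, a} \<in> E" using is_matching_subset[OF mM1] by blast
    have "a \<in> \<Union>M2" using max_matching_no_edge[OF M2 less.prems(7)] vaE by blast
    then obtain b where ab: "{a, b} \<in> M2" "b \<noteq> a" using matching_edge[OF mM2] by blast
    then have abE: "{a, b} \<in> E" using is_matching_subset[OF mM2] by blast
    have bv: "b \<noteq> v" using ab less.prems(7) by auto
    have au: "a \<noteq> u" "a \<noteq> w" using va less.prems(5,6) by auto
    show ?thesis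
    proof (cases "b \<in> \<Union>M1")
      case False
      have av: "{a, v} \<in> M1" and ba: "{b, a} \<in> E" using va abE by (auto simp: insert_commute)
      note r = rotate[OF M1 av False ba]
      show ?thesis
        by (rule exI[of _ "insert {b, a} (M1 - {{a, v}})"])
          (use r less.prems(4-9) va bv in \<open>auto simp del: Union_insert\<close>)
    next
      case True
      have bu: "b \<noteq> u" "b \<noteq> w" using True less.prems(5,6) by auto
      define E' where "E' = {e \<in> E. v \<notin> e \<and> a \<notin> e}"
      define N1 where "N1 = M1 - {{v, a}}"
      define N2 where "N2 = M2 - {{a, b}}"
      have E': "finite_edges E'" using finite_E card_E unfolding E'_def by unfold_locales auto
      have UN1: "\<Union>N1 = \<Union>M1 - {v, a}" unfolding N1_def by (rule Union_matching_diff[OF mM1 va(1)])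
      have UN2: "\<Union>N2 = \<Union>M2 - {a, b}" unfolding N2_def by (rule Union_matching_diff[OF mM2 ab(1)])
      have restrict: "is_matching E' N" if "is_matching E N" "v \<notin> \<Union>N" "a \<notin> \<Union>N" for N
      proof (rule is_matching_mono[OF that(1)])
        show "N \<subseteq> E'" using that is_matching_subset[OF that(1)] unfolding E'_def by blast
      qed
      have cN1: "Suc (card N1) = card M1" unfolding N1_def using va fM1 by (metis card_Suc_Diff1)
      have cN2: "Suc (card N2) = card M1"
        unfolding N2_def card_eq using ab fM2 by (metis card_Suc_Diff1)
      have extend: "is_matching E (insert e N) \<and> card (insert e N) = Suc (card N)"
        if N: "is_matching E' N" and e: "e \<in> E" "e \<inter> \<Union>N = {}" for N e
      proof -
        have N': "is_matching E N"
          using is_matching_mono[OF N] is_matching_subset[OF N] unfolding E'_def by blast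
        have "e \<noteq> {}" using card_E[OF e(1)] by auto
        then have "e \<notin> N" using e(2) by auto
        then show ?thesis using is_matching_insert[OF N' e] finite_matching[OF N'] by simp
      qed
      \<comment> \<open>A matching of \<open>E'\<close> extends by the edge \<open>{v, a}\<close>,
        so maximality of \<open>M1\<close> makes \<open>N1\<close> and \<open>N2\<close> maximum in
        \<open>E'\<close>.\<close>
      have bound: "card N \<le> card N1" if N: "is_matching E' N" for N
      proof -
        have "{v, a} \<inter> \<Union>N = {}" using is_matching_subset[OF N] unfolding E'_def by blast
        from extend[OF N vaE this] M1 have "Suc (card N) \<le> card M1"
          unfolding max_matching_def by metis
        then show ?thesis using cN1 by simp
      qed
      have mN1: "is_matching E' N1"
        by (rule restrict) (use mM1 UN1 in \<open>auto simp: N1_def intro: is_matching_diff\<close>)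
      have mN2: "is_matching E' N2"
        by (rule restrict) (use mM2 UN2 less.prems(7) in \<open>auto simp: N2_def intro: is_matching_diff\<close>)
      have "max_matching E' N1" "max_matching E' N2"
        using mN1 mN2 bound cN1 cN2 unfolding max_matching_def by (metis Suc_inject)+
      then have "\<exists>M. max_matching E' M \<and> b \<notin> \<Union>M \<and> (u \<notin> \<Union>M \<or> w \<notin> \<Union>M)"
        using cN1 E' UN1 UN2 less.prems(4-6) bu by (intro less.hyps[of N1 E' N2 b]) auto
      then obtain M3 where M3: "max_matching E' M3" "b \<notin> \<Union>M3" "u \<notin> \<Union>M3 \<or> w \<notin> \<Union>M3"
        by metis
      have m3: "is_matching E' M3" using max_matchingD[OF M3(1)] .
      have va3: "v \<notin> \<Union>M3" "a \<notin> \<Union>M3"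
        using is_matching_subset[OF m3] unfolding E'_def by auto
      \<comment> \<open>Completing \<open>M3\<close> with \<open>{a, b}\<close> instead of
        \<open>{v, a}\<close> restores the size of \<open>M1\<close> and leaves \<open>v\<close>
        exposed.\<close>
      have "is_matching E (insert {a, b} M3) \<and> card (insert {a, b} M3) = Suc (card M3)"
        using va3 M3(2) by (intro extend[OF m3 abE]) auto
      moreover have "card M3 = card N1"
        using M3(1) mN1 bound[OF m3] by (simp add: max_matching_def le_antisym)
      ultimately have "max_matching E (insert {a, b} M3)"
        using M1 cN1 by (intro max_matchingI[OF M1]) auto
      then show ?thesis
        using va3 M3(2,3) va(2) bv au bu by (intro exI[of _ "insert {a, b} M3"]) auto
    qed
  qed
qed

section \<open>Rotations and the matching criterion for expanders\<close>

context finite_edges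
begin

text \<open>The condition \<open>w \<noteq> v\<close> keeps \<open>v\<close> exposed throughout;
  only the other exposed vertices move.\<close>

inductive_set rotations :: "'a set set \<Rightarrow> 'a \<Rightarrow> 'a set set set" for M v where
  base: "M \<in> rotations M v"
| step: "\<lbrakk>N \<in> rotations M v; w \<noteq> v; w \<notin> \<Union>N; {w, x} \<in> E; {x, y} \<in> N\<rbrakk>
    \<Longrightarrow> insert {w, x} (N - {{x, y}}) \<in> rotations M v"

lemma rotations_max_matching:
  assumes "max_matching E M" "v \<notin> \<Union>M" "N \<in> rotations M v"
  shows "max_matching E N \<and> v \<notin> \<Union>N"
  using assms(3)
proof induction
  case base
  then show ?case using assms by simp
next
  case (step N w x y)
  have "max_matching E N" using step by blast
  note r = rotate[OF this step.hyps(5,3,4)]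
  then show ?case using step by auto
qed

text \<open>A vertex \<open>x\<close> that is never exposed can only lose its partner \<open>z\<close> in a rotation that exposes \<open>z\<close>.\<close>

lemma max_matching_few_neighbours:
  assumes M: "max_matching E M" and v: "v \<notin> \<Union>M" and w0: "w0 \<notin> \<Union>M" "w0 \<noteq> v"
    and fV: "finite V" "\<Union>E \<subseteq> V" "w0 \<in> V"
  obtains S where "S \<subseteq> {w \<in> V. w \<noteq> v \<and> (\<exists>N. max_matching E N \<and> v \<notin> \<Union>N \<and> w \<notin> \<Union>N)}"
    "S \<noteq> {}" "card (neighbours E S) < card S"
proof -
  define S where "S = {w \<in> V. w \<noteq> v \<and> (\<exists>N \<in> rotations M v. w \<notin> \<Union>N)}"
  note rm = rotations_max_matching[OF M v]
  have fS: "finite S" unfolding S_def using fV by auto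
  have mM: "is_matching E M" using M max_matchingD by blast
  have vM: "y \<noteq> v" if "{x, y} \<in> M" for x y using that v by blast
  have inV: "x \<in> V \<and> y \<in> V" if "{x, y} \<in> E" for x y using that fV by blast
  have w0S: "w0 \<in> S" unfolding S_def using w0 fV rotations.base by blast
  have partner: "\<exists>z. {x, z} \<in> M \<and> z \<in> S" if x: "x \<in> neighbours E S" for x
  proof -
    obtain w where w: "w \<in> S" "{w, x} \<in> E" "x \<notin> S" using x unfolding neighbours_def by blast
    obtain N where N: "N \<in> rotations M v" "w \<notin> \<Union>N" "w \<noteq> v" using w(1) unfolding S_def by blast
    \<comment> \<open>\<open>N\<close> exposes both \<open>w\<close> and \<open>v\<close>, so they
      cannot be joined by an edge.\<close>
    have xv: "x \<noteq> v" using max_matching_no_edge[of N w x] rm[OF N(1)] N w(2) by blast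
    have xV: "x \<in> V" using inV[OF w(2)] by simp
    have SI: "u \<in> S" if "u \<in> V" "u \<noteq> v" "N' \<in> rotations M v" "u \<notin> \<Union>N'" for u N'
      unfolding S_def using that(1,2) bexI[of "\<lambda>N. u \<notin> \<Union>N", OF that(4,3)] by simp
    have cov: "x \<in> \<Union>N'" if "N' \<in> rotations M v" for N'
      using SI[OF xV xv that] w(3) by argo
    obtain z where z: "{x, z} \<in> M" using cov[OF rotations.base] matching_edge[OF mM] by blast
    have zV: "z \<in> V" "z \<noteq> v" using inV[OF is_matching_subset[OF mM z]] vM[OF z] by auto
    have keep: "{x, z} \<in> N' \<or> z \<in> S" if "N' \<in> rotations M v" for N'
      using that
    proof induction
      case base
      then show ?case using z by simp
    next
      case (step N' w' x' y')
      have N'': "insert {w', x'} (N' - {{x', y'}}) \<in> rotations M v" (is "?N \<in> _")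
        using rotations.step[OF step.hyps] .
      have mm: "max_matching E N'" using rm[OF step.hyps(1)] by simp
      have "y' \<notin> \<Union>?N" unfolding rotate(2)[OF mm step.hyps(5,3,4)]
        using rotate(3)[OF mm step.hyps(5,3,4)] by simp
      moreover from this have "y' \<noteq> x" using cov[OF N''] by metis
      ultimately have z_in: "z \<in> S" if "{x, z} = {x', y'}"
        using that SI[OF zV N''] by (auto simp: doubleton_eq_iff)
      show ?case
      proof (cases "{x, z} = {x', y'}")
        case False
        then show ?thesis using step.IH by auto
      qed (use z_in in simp)
    qed
    have "z \<in> S"
    proof (cases "{x, z} \<in> N")
      case True
      have N'': "insert {w, x} (N - {{x, z}}) \<in> rotations M v" (is "?N \<in> _")
        using rotations.step[OF N(1,3,2) w(2) True] .
      have mm: "max_matching E N" using rm[OF N(1)] by simp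
      have "z \<notin> \<Union>?N" unfolding rotate(2)[OF mm True N(2) w(2)]
        using rotate(3)[OF mm True N(2) w(2)] by simp
      then show ?thesis using SI[OF zV N''] by simp
    next
      case False
      then show ?thesis using keep[OF N(1)] by blast
    qed
    with z show ?thesis by auto
  qed
  then obtain f where f: "\<And>x. x \<in> neighbours E S \<Longrightarrow> {x, f x} \<in> M \<and> f x \<in> S" by metis
  have "inj_on f (neighbours E S)"
  proof (rule inj_onI)
    fix x y assume "x \<in> neighbours E S" "y \<in> neighbours E S" "f x = f y"
    then have "{f x, x} \<in> M" "{f x, y} \<in> M" using f by (metis insert_commute)+
    then show "x = y" using matching_edge_unique[OF mM] by blast
  qed
  \<comment> \<open>\<open>M\<close> exposes \<open>w0\<close>, so \<open>w0\<close> is nobody's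
    partner; this makes the final inequality strict.\<close>
  moreover have "f ` neighbours E S \<subseteq> S - {w0}"
  proof (rule image_subsetI)
    fix x assume "x \<in> neighbours E S"
    then have "f x \<in> S" "f x \<in> \<Union>M" using f[of x] by (auto intro: UnionI[of "{x, f x}"])
    then show "f x \<in> S - {w0}" using w0(1) by auto
  qed
  ultimately have "card (neighbours E S) \<le> card (S - {w0})"
    using fS by (metis card_inj_on_le finite_Diff)
  also have "\<dots> < card S" using card_Diff1_less[OF fS w0S] .
  finally have "card (neighbours E S) < card S" .
  moreover have "S \<subseteq> {w \<in> V. w \<noteq> v \<and> (\<exists>N. max_matching E N \<and> v \<notin> \<Union>N \<and> w \<notin> \<Union>N)}"
    unfolding S_def using rm by fast
  moreover have "S \<noteq> {}" using w0S by auto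
  ultimately show ?thesis using that[of S] by simp
qed

lemma card_Union_matching:
  assumes "is_matching E M"
  shows "card (\<Union>M) = 2 * card M"
proof -
  have fin: "finite e" if "e \<in> M" for e
    using card_E[OF is_matching_subset[OF assms that]] card_ge_0_finite[of e] by simp
  have "card (\<Union>M) = (\<Sum>e\<in>M. card e)"
    using assms fin by (intro card_Union_disjoint) (auto simp: is_matching_def pairwise_def disjnt_def)
  also have "\<dots> = (\<Sum>e\<in>M. 2)"
    using assms card_E by (intro sum.cong) (auto simp: is_matching_def)
  finally show ?thesis by simp
qed

text \<open>Suppose there is no perfect matching, and let \<open>D\<close> be the set of vertices missed by some maximum matching. By Gallai's lemma,
  never being missed simultaneously is an equivalence relation on \<open>D\<close>, and no edge of the graph
  joins two classes. Expansion makes the complement of every class in \<open>D\<close> large, so the classes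
  can be grouped into two large parts without an edge between them.\<close>

lemma expander_perfect_matching:
  fixes b :: real
  assumes fV: "finite V" "\<Union>E \<subseteq> V" "even (card V)" and b: "b > 0"
    and expand: "\<And>S. \<lbrakk>S \<subseteq> V; S \<noteq> {}; real (card S) \<le> 3 * b\<rbrakk> \<Longrightarrow> card S \<le> card (neighbours E S)"
    and connect: "\<And>A B. \<lbrakk>A \<subseteq> V; B \<subseteq> V; A \<inter> B = {}; real (card A) \<ge> b; real (card B) \<ge> b\<rbrakk>
        \<Longrightarrow> \<exists>x\<in>A. \<exists>y\<in>B. {x, y} \<in> E"
  shows "\<exists>M. is_matching E M \<and> \<Union>M = V"
proof (rule ccontr)
  assume no: "\<not> ?thesis"
  define misses where "misses = (\<lambda>M v. max_matching E M \<and> v \<notin> \<Union>M)"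
  define D where "D = {v \<in> V. \<exists>M. misses M v}"
  define both where "both = (\<lambda>u w. u \<noteq> w \<and> (\<exists>M. misses M u \<and> misses M w))"
  define cls where "cls = (\<lambda>v. {w \<in> D. \<not> both v w})"
  have fD: "finite D" unfolding D_def using fV by auto
  have sym: "both u w \<Longrightarrow> both w u" for u w unfolding both_def by blast
  have refl: "v \<in> D \<Longrightarrow> v \<in> cls v" for v unfolding cls_def both_def by blast
  \<comment> \<open>Gallai's lemma, read contrapositively: the negation of \<open>both\<close> is
    transitive on \<open>D\<close>.\<close>
  have trans: "both v u \<or> both v w" if uvw: "both u w" "v \<in> D" "v \<noteq> u" "v \<noteq> w" for u v w
  proof -
    obtain M1 M2 where M12: "misses M1 u" "misses M1 w" "u \<noteq> w" "misses M2 v"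
      using uvw(1,2) unfolding both_def D_def by blast
    then have "\<exists>M. max_matching E M \<and> v \<notin> \<Union>M \<and> (u \<notin> \<Union>M \<or> w \<notin> \<Union>M)"
      using uvw(3,4) unfolding misses_def
      by (intro gallai_exchange[OF finite_edges_axioms, of M1 M2 u w v]) auto
    then have "\<exists>M. misses M v \<and> (misses M u \<or> misses M w)"
      unfolding misses_def by metis
    then show ?thesis using uvw(3,4) unfolding both_def by blast
  qed
  \<comment> \<open>The set given by \<open>max_matching_few_neighbours\<close> violates expansion
    unless it has more than \<open>3 * b\<close> elements.\<close>
  have large: "real (card (D - cls v)) > 3 * b" if vD: "v \<in> D" for v
  proof -
    obtain M where M: "max_matching E M" "v \<notin> \<Union>M" "v \<in> V"
      using vD unfolding D_def misses_def by auto
    have mM: "is_matching E M" using max_matchingD[OF M(1)] .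
    have sub: "\<Union>M \<subseteq> V - {v}" using is_matching_subset[OF mM] M fV by blast
    \<comment> \<open>Parity: \<open>M\<close> covers an even number of vertices, so besides
      \<open>v\<close> it misses a second one.\<close>
    have "\<Union>M \<noteq> V - {v}"
    proof
      assume "\<Union>M = V - {v}"
      then have "card V = Suc (2 * card M)"
        using card_Union_matching[OF mM] M fV by (metis card_Suc_Diff1)
      then show False using fV by simp
    qed
    then obtain w0 where w0: "w0 \<notin> \<Union>M" "w0 \<noteq> v" "w0 \<in> V" using sub by blast
    obtain S where S: "S \<subseteq> {w \<in> V. w \<noteq> v \<and> (\<exists>N. max_matching E N \<and> v \<notin> \<Union>N \<and> w \<notin> \<Union>N)}"
      "S \<noteq> {}" "card (neighbours E S) < card S"
      by (rule max_matching_few_neighbours[OF M(1,2) w0(1,2) fV(1,2) w0(3)])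
    have "w \<in> D - cls v" if "w \<in> S" for w
    proof -
      obtain N where "max_matching E N" "v \<notin> \<Union>N" "w \<notin> \<Union>N" "w \<noteq> v" "w \<in> V"
        using S(1) \<open>w \<in> S\<close> by auto
      then show ?thesis unfolding D_def cls_def both_def misses_def by auto
    qed
    then have SD: "S \<subseteq> D - cls v" by blast
    from SD have "card S \<le> card (D - cls v)" using fD by (intro card_mono) auto
    moreover have "\<not> real (card S) \<le> 3 * b"
    proof
      assume le: "real (card S) \<le> 3 * b"
      have "S \<subseteq> V" using SD unfolding D_def by blast
      from expand[OF this S(2) le] S(3) show False by simp
    qed
    ultimately show ?thesis by linarith
  qed
  have no_edge: "{u, w} \<notin> E" if "both u w" for u w
    using that max_matching_no_edge unfolding both_def misses_def by metis
  define closed where "closed = (\<lambda>A. A \<subseteq> D \<and> (\<forall>v\<in>A. cls v \<subseteq> A))"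
  \<comment> \<open>Vertices of different classes are missed together by some maximum matching,
    which an edge between them would enlarge.\<close>
  have sep: False if A: "closed A" "real (card A) \<ge> b" "real (card (D - A)) \<ge> b" for A
  proof -
    have "\<exists>x\<in>A. \<exists>y\<in>D - A. {x, y} \<in> E"
      using A unfolding closed_def D_def by (intro connect) auto
    then obtain x y where xy: "x \<in> A" "y \<in> D - A" "{x, y} \<in> E" by blast
    then have "both x y" using A unfolding closed_def cls_def by blast
    then show False using no_edge xy by blast
  qed
  have cls_closed: "cls w \<subseteq> cls v" if "w \<in> cls v" "v \<in> D" for v w
    using that trans sym unfolding cls_def by blast
  have "D \<noteq> {}"
  proof -
    obtain M where M: "max_matching E M" using max_matching_exists finite_E by blast
    then have "\<Union>M \<subseteq> V" using fV is_matching_subset[OF max_matchingD[OF M]] by blast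
    moreover have "\<Union>M \<noteq> V" using no max_matchingD[OF M] by metis
    ultimately obtain v where "v \<in> V" "v \<notin> \<Union>M" by (metis psubsetI psubset_imp_ex_mem DiffE)
    then show ?thesis using M unfolding D_def misses_def by auto
  qed
  then obtain v0 where v0: "v0 \<in> D" by blast
  have small: "real (card (cls v)) < b" if "v \<in> D" for v
  proof (rule ccontr)
    assume "\<not> ?thesis"
    moreover have "closed (cls v)" using cls_closed that unfolding closed_def cls_def by blast
    ultimately show False using sep[of "cls v"] large[OF that] b by linarith
  qed
  have cardD: "real (card D) > 3 * b"
    using large[OF v0] card_mono[of D "D - cls v0"] fD by fastforce
  \<comment> \<open>A smallest union of classes with at least \<open>b\<close> elements has fewer
    than \<open>2 * b\<close>: dropping one class, itself smaller than \<open>b\<close>, leaves less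
    than \<open>b\<close>. More than \<open>b\<close> elements of \<open>D\<close> then lie outside,
    because \<open>card D\<close> exceeds \<open>3 * b\<close>; this fixes the range
    \<open>3 * b\<close> in \<open>expand\<close>.\<close>
  have "\<exists>A. (closed A \<and> real (card A) \<ge> b) \<and> (\<forall>B. closed B \<and> real (card B) \<ge> b \<longrightarrow> card A \<le> card B)"
    by (rule ex_has_least_nat[of _ D]) (use cardD b in \<open>auto simp: closed_def cls_def\<close>)
  then obtain A where A: "closed A" "real (card A) \<ge> b"
    and Amin: "\<And>B. closed B \<Longrightarrow> real (card B) \<ge> b \<Longrightarrow> card A \<le> card B" by blast
  have fA: "finite A" "A \<subseteq> D" using A fD finite_subset unfolding closed_def by blast+
  have "A \<noteq> {}" using A b by auto
  then obtain v where v: "v \<in> A" "v \<in> D" using fA by blast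
  have "closed (A - cls v)"
    using A trans sym v unfolding closed_def cls_def by blast
  moreover have "card (A - cls v) < card A"
    using v refl fA by (intro psubset_card_mono) auto
  ultimately have "real (card (A - cls v)) < b" using Amin by force
  moreover have "card A \<le> card (A - cls v) + card (cls v)"
  proof -
    have "card A \<le> card ((A - cls v) \<union> cls v)"
      using fA fD by (intro card_mono) (auto simp: cls_def)
    then show ?thesis using card_Un_le le_trans by blast
  qed
  ultimately have "real (card A) < 2 * b" using small[OF v(2)] by linarith
  moreover have "card (D - A) = card D - card A" "card A \<le> card D"
    using fA fD by (auto intro: card_Diff_subset card_mono)
  ultimately have "real (card (D - A)) \<ge> b" using cardD by linarith
  then show False using sep A by blast
qed

end

section \<open>Random subsets\<close>

text \<open>Markov's inequality in the form behind both the exponential tail bounds and Chebyshev;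
  finite support supplies integrability.\<close>

lemma measure_pmf_le_expectation:
  fixes f :: "'a \<Rightarrow> real"
  assumes fin: "finite (set_pmf M)" and ge: "\<And>x. x \<in> set_pmf M \<Longrightarrow> f x \<ge> 0"
    "\<And>x. x \<in> set_pmf M \<Longrightarrow> x \<in> A \<Longrightarrow> f x \<ge> 1"
  shows "measure_pmf.prob M A \<le> measure_pmf.expectation M f"
proof -
  have "measure_pmf.prob M A = measure_pmf.expectation M (indicator A)" by simp
  also have "\<dots> \<le> measure_pmf.expectation M f"
    using fin ge by (intro integral_mono_AE integrable_measure_pmf_finite)
      (auto simp: AE_measure_pmf_iff indicator_def)
  finally show ?thesis .
qed

context
  fixes A :: "'a set" and p :: real
  assumes fin: "finite A" and p: "0 \<le> p" "p \<le> 1"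
begin

abbreviation (input) random_subset :: "('a \<Rightarrow> bool) pmf" where
  "random_subset \<equiv> Pi_pmf A False (\<lambda>_. bernoulli_pmf p)"

lemma finite_set_random_subset: "finite (set_pmf random_subset)"
  unfolding set_Pi_pmf[OF fin] by (intro finite_PiE_dflt fin finite)

text \<open>Independence factors the expectation over the coordinates. The value
  \<open>l = 0\<close> gives the probability that \<open>Q\<close> is avoided,
  \<open>l \<le> 1\<close> the lower tail, \<open>l \<ge> 1\<close> the upper tail. The forced set
  \<open>F\<close> will be a chain of copies.\<close>

lemma expectation_power_count:
  fixes l :: real
  assumes FQ: "F \<subseteq> A" "Q \<subseteq> A" "F \<inter> Q = {}" and l: "l \<ge> 0"
  shows "measure_pmf.expectation random_subset
           (\<lambda>\<omega>. of_bool (\<forall>c\<in>F. \<omega> c) * l ^ card {c \<in> Q. \<omega> c})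
         = p ^ card F * (1 - p + p * l) ^ card Q" (is "?L = _")
proof -
  define g where "g = (\<lambda>c b. if c \<in> F then of_bool b else if c \<in> Q then (if b then l else 1) else (1::real))"
  have fFQ: "finite F" "finite Q" using FQ fin by (auto intro: finite_subset)
  have "(\<Prod>c\<in>A. g c (\<omega> c)) = of_bool (\<forall>c\<in>F. \<omega> c) * l ^ card {c \<in> Q. \<omega> c}" for \<omega>
  proof -
    have "(\<Prod>c\<in>A. g c (\<omega> c)) = (\<Prod>c\<in>A - (F \<union> Q). g c (\<omega> c)) * (\<Prod>c\<in>F \<union> Q. g c (\<omega> c))"
      using FQ fin by (intro prod.subset_diff) auto
    moreover have "(\<Prod>c\<in>F \<union> Q. g c (\<omega> c)) = (\<Prod>c\<in>F. g c (\<omega> c)) * (\<Prod>c\<in>Q. g c (\<omega> c))"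
      using FQ fFQ by (intro prod.union_disjoint) auto
    moreover have "(\<Prod>c\<in>A - (F \<union> Q). g c (\<omega> c)) = 1" by (intro prod.neutral) (auto simp: g_def)
    moreover have "(\<Prod>c\<in>F. g c (\<omega> c)) = of_bool (\<forall>c\<in>F. \<omega> c)"
      using fFQ(1) by (auto simp: g_def prod_zero_iff)
    moreover have "(\<Prod>c\<in>Q. g c (\<omega> c)) = (\<Prod>c\<in>Q. if \<omega> c then l else 1)"
      using FQ by (intro prod.cong) (auto simp: g_def)
    moreover have "\<dots> = l ^ card {c \<in> Q. \<omega> c}"
      using fFQ(2) by (simp add: prod.If_cases Int_def)
    ultimately show ?thesis by simp
  qed
  then have "?L = measure_pmf.expectation random_subset (\<lambda>\<omega>. \<Prod>c\<in>A. g c (\<omega> c))" by simp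
  also have "\<dots> = (\<Prod>c\<in>A. measure_pmf.expectation (bernoulli_pmf p) (g c))"
    using l by (intro expectation_prod_Pi_pmf fin integrable_measure_pmf_finite)
      (auto simp: g_def)
  also have "\<dots> = (\<Prod>c\<in>A. if c \<in> F then p else if c \<in> Q then 1 - p + p * l else 1)"
    using p by (intro prod.cong refl) (auto simp: g_def)
  also have "\<dots> = (\<Prod>c\<in>F. p) * (\<Prod>c\<in>Q. 1 - p + p * l)"
  proof -
    have "(\<Prod>c\<in>A. if c \<in> F then p else if c \<in> Q then 1 - p + p * l else 1) =
          (\<Prod>c\<in>F \<union> Q. if c \<in> F then p else if c \<in> Q then 1 - p + p * l else 1)"
      using FQ fin by (intro prod.mono_neutral_right) auto
    also have "\<dots> = (\<Prod>c\<in>F. if c \<in> F then p else if c \<in> Q then 1 - p + p * l else 1) *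
        (\<Prod>c\<in>Q. if c \<in> F then p else if c \<in> Q then 1 - p + p * l else 1)"
      using FQ fFQ by (intro prod.union_disjoint) auto
    also have "\<dots> = (\<Prod>c\<in>F. p) * (\<Prod>c\<in>Q. 1 - p + p * l)"
      using FQ by (intro arg_cong2[of _ _ _ _ "(*)"] prod.cong) auto
    finally show ?thesis .
  qed
  finally show ?thesis by simp
qed

lemma prob_none_included:
  assumes "Q \<subseteq> A"
  shows "measure_pmf.prob random_subset {\<omega>. \<forall>c\<in>Q. \<not> \<omega> c} = (1 - p) ^ card Q"
proof -
  have fQ: "finite Q" using assms fin finite_subset by blast
  \<comment> \<open>As \<open>0 ^ 0 = 1\<close>, the power is exactly the indicator of the
    event.\<close>
  have "indicator {\<omega>. \<forall>c\<in>Q. \<not> \<omega> c} \<omega> = (0::real) ^ card {c \<in> Q. \<omega> c}" for \<omega>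
    using fQ by (auto simp: indicator_def power_0_left)
  then have "measure_pmf.prob random_subset {\<omega>. \<forall>c\<in>Q. \<not> \<omega> c}
      = measure_pmf.expectation random_subset (\<lambda>\<omega>. 0 ^ card {c \<in> Q. \<omega> c})"
    by (subst Bochner_Integration.integral_cong[OF refl, of _ _ "indicator {\<omega>. \<forall>c\<in>Q. \<not> \<omega> c}"]) simp_all
  also have "\<dots> = (1 - p) ^ card Q"
    using expectation_power_count[of "{}" Q 0] assms by simp
  finally show ?thesis .
qed

lemma prob_few_included:
  fixes l :: real
  assumes FQ: "F \<subseteq> A" "Q \<subseteq> A" "F \<inter> Q = {}" and l: "0 < l" "l \<le> 1"
  shows "measure_pmf.prob random_subset {\<omega>. (\<forall>c\<in>F. \<omega> c) \<and> card {c \<in> Q. \<omega> c} \<le> k}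
         \<le> p ^ card F * (1 - p + p * l) ^ card Q / l ^ k"
proof -
  have "measure_pmf.prob random_subset {\<omega>. (\<forall>c\<in>F. \<omega> c) \<and> card {c \<in> Q. \<omega> c} \<le> k}
    \<le> measure_pmf.expectation random_subset
      (\<lambda>\<omega>. (of_bool (\<forall>c\<in>F. \<omega> c) * l ^ card {c \<in> Q. \<omega> c}) / l ^ k)"
    using l finite_set_random_subset
    by (intro measure_pmf_le_expectation) (auto simp: power_decreasing)
  also have "\<dots> = p ^ card F * (1 - p + p * l) ^ card Q / l ^ k"
    using expectation_power_count[OF FQ, of l] l by simp
  finally show ?thesis .
qed

lemma prob_many_included:
  fixes l :: real
  assumes Q: "Q \<subseteq> A" and l: "1 \<le> l"
  shows "measure_pmf.prob random_subset {\<omega>. card {c \<in> Q. \<omega> c} \<ge> k}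
         \<le> (1 - p + p * l) ^ card Q / l ^ k"
proof -
  have "measure_pmf.prob random_subset {\<omega>. card {c \<in> Q. \<omega> c} \<ge> k}
    \<le> measure_pmf.expectation random_subset
      (\<lambda>\<omega>. (of_bool (\<forall>c\<in>{}. \<omega> c) * l ^ card {c \<in> Q. \<omega> c}) / l ^ k)"
    using l finite_set_random_subset
    by (intro measure_pmf_le_expectation) (auto simp: power_increasing)
  also have "\<dots> = (1 - p + p * l) ^ card Q / l ^ k"
    using expectation_power_count[of "{}" Q l] l Q by (simp del: of_bool_eq)
  finally show ?thesis .
qed

end

section \<open>Monotonicity in the inclusion probability\<close>

lemma prob_bind_bernoulli:
  assumes "0 \<le> p" "p \<le> 1"
  shows "measure_pmf.prob (bind_pmf (bernoulli_pmf p) f) S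
    = p * measure_pmf.prob (f True) S + (1 - p) * measure_pmf.prob (f False) S"
proof -
  have "measure_pmf.prob (bind_pmf (bernoulli_pmf p) f) S
      = measure_pmf.expectation (bernoulli_pmf p) (\<lambda>b. measure_pmf.prob (f b) S)"
    unfolding measure_pmf_bind
    by (subst measure_pmf.measure_bind[where N = "count_space UNIV"]) (auto simp: space_subprob_algebra measure_pmf.subprob_space_axioms)
  then show ?thesis using assms by simp
qed

text \<open>Reveal one coordinate. By induction each slice becomes likelier, and since
  \<open>P\<close> is increasing the slice with the coordinate included dominates the other, so
  raising its weight from \<open>p\<close> to \<open>q\<close> helps as well.\<close>

lemma prob_increasing_mono:
  fixes p q :: real
  assumes "finite A" and pq: "0 \<le> p" "p \<le> q" "q \<le> 1"
    and inc: "\<And>\<omega> \<omega>'. P \<omega> \<Longrightarrow> (\<And>c. \<omega> c \<Longrightarrow> \<omega>' c) \<Longrightarrow> P \<omega>'"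
  shows "measure_pmf.prob (Pi_pmf A False (\<lambda>_. bernoulli_pmf p)) {\<omega>. P \<omega>}
       \<le> measure_pmf.prob (Pi_pmf A False (\<lambda>_. bernoulli_pmf q)) {\<omega>. P \<omega>}"
  using assms(1) inc
proof (induction A arbitrary: P rule: finite_induct)
  case empty
  then show ?case by simp
next
  case (insert x A)
  define prb where "prb = (\<lambda>p b. measure_pmf.prob (Pi_pmf A False (\<lambda>_. bernoulli_pmf p)) {\<omega>. P (fun_upd \<omega> x b)})"
  have eq: "measure_pmf.prob (Pi_pmf (insert x A) False (\<lambda>_. bernoulli_pmf r)) {\<omega>. P \<omega>}
      = r * prb r True + (1 - r) * prb r False" if "0 \<le> r" "r \<le> 1" for r :: real
  proof -
    have "measure_pmf.prob (Pi_pmf (insert x A) False (\<lambda>_. bernoulli_pmf r)) {\<omega>. P \<omega>}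
      = measure_pmf.prob (bind_pmf (bernoulli_pmf r)
          (\<lambda>y. map_pmf (\<lambda>f. fun_upd f x y) (Pi_pmf A False (\<lambda>_. bernoulli_pmf r)))) {\<omega>. P \<omega>}"
      using insert.hyps by (simp add: Pi_pmf_insert' map_pmf_def)
    also have "\<dots> = r * prb r True + (1 - r) * prb r False"
      using that by (simp add: prob_bind_bernoulli prb_def vimage_def)
    finally show ?thesis .
  qed
  have IH: "prb p b \<le> prb q b" for b
    unfolding prb_def by (rule insert.IH) (erule insert.prems, auto)
  have mono: "prb p False \<le> prb p True"
    unfolding prb_def by (intro measure_pmf.finite_measure_mono) (auto elim!: insert.prems)
  have "p * prb p True + (1 - p) * prb p False \<le> q * prb p True + (1 - q) * prb p False"
    using mult_nonneg_nonneg[of "q - p" "prb p True - prb p False"] mono pq by (simp add: algebra_simps)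
  also have "\<dots> \<le> q * prb q True + (1 - q) * prb q False"
    using IH pq by (intro add_mono mult_left_mono) auto
  finally show ?case using eq pq by simp
qed

section \<open>Counting copies\<close>

lemma sum_card_swap:
  assumes "finite A" "finite B"
  shows "(\<Sum>a\<in>A. card {b \<in> B. R a b}) = (\<Sum>b\<in>B. card {a \<in> A. R a b})"
  using sum_multicount_gen[OF assms, of R "\<lambda>b. card {a \<in> A. R a b}"] by simp

definition relabel :: "('a \<Rightarrow> 'b) \<Rightarrow> 'a ugraph \<Rightarrow> 'b ugraph" where
  "relabel f G = (f ` verts G, (`) f ` edges G)"

lemma edge_relabel_iff:
  assumes "inj_on f (verts G)" "simple_graph G" "u \<in> verts G" "v \<in> verts G"
  shows "{f u, f v} \<in> edges (relabel f G) \<longleftrightarrow> {u, v} \<in> edges G"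
proof
  assume "{f u, f v} \<in> edges (relabel f G)"
  then obtain e where e: "e \<in> edges G" "f ` {u, v} = f ` e" by (auto simp: relabel_def)
  then have "e \<subseteq> verts G" using assms(2) by (auto simp: simple_graph_def)
  then have "{u, v} = e" using e(2) assms by (subst (asm) inj_on_image_eq_iff) auto
  then show "{u, v} \<in> edges G" using e by simp
next
  assume "{u, v} \<in> edges G"
  then have "f ` {u, v} \<in> edges (relabel f G)" unfolding relabel_def snd_conv by (rule imageI)
  then show "{f u, f v} \<in> edges (relabel f G)" by simp
qed

lemma simple_graph_relabel:
  assumes "inj_on f (verts G)" "simple_graph G"
  shows "simple_graph (relabel f G)"
  using assms by (auto simp: simple_graph_def relabel_def card_image inj_on_subset)

lemma graph_isomorphic_relabel:
  assumes "inj_on f (verts G)" "simple_graph G"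
  shows "graph_isomorphic G (relabel f G)"
  unfolding graph_isomorphic_def
  using edge_relabel_iff[OF assms] assms(1)
  by (intro exI[of _ f]) (auto simp: relabel_def bij_betw_def)

lemma graph_isomorphic_trans:
  assumes "graph_isomorphic G H" "graph_isomorphic H K"
  shows "graph_isomorphic G K"
proof -
  obtain f where f: "bij_betw f (verts G) (verts H)"
    "\<And>u v. u \<in> verts G \<Longrightarrow> v \<in> verts G \<Longrightarrow> {u, v} \<in> edges G \<longleftrightarrow> {f u, f v} \<in> edges H"
    using assms(1) unfolding graph_isomorphic_def by blast
  obtain g where g: "bij_betw g (verts H) (verts K)"
    "\<And>u v. u \<in> verts H \<Longrightarrow> v \<in> verts H \<Longrightarrow> {u, v} \<in> edges H \<longleftrightarrow> {g u, g v} \<in> edges K"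
    using assms(2) unfolding graph_isomorphic_def by blast
  have "f u \<in> verts H" if "u \<in> verts G" for u using f(1) that by (auto simp: bij_betw_def)
  then show ?thesis unfolding graph_isomorphic_def
    using f g by (intro exI[of _ "g \<circ> f"]) (auto intro: bij_betw_trans)
qed

lemma subgraph_complete_graph_iff:
  "subgraph C (complete_graph n) \<longleftrightarrow> simple_graph C \<and> verts C \<subseteq> {1..n}"
  unfolding subgraph_def complete_graph_def simple_graph_def by auto

lemma relabel_in_copies:
  assumes "simple_graph G" "graph_isomorphic H G" "inj_on f (verts G)" "f ` verts G \<subseteq> {1..n}"
  shows "relabel f G \<in> copies H n"
  using assms graph_isomorphic_trans[OF assms(2) graph_isomorphic_relabel[OF assms(3,1)]]
    simple_graph_relabel[OF assms(3,1)]
  by (auto simp: copies_def subgraph_complete_graph_iff relabel_def)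

lemma graph_isomorphic_refl: "graph_isomorphic G G"
  unfolding graph_isomorphic_def by (intro exI[of _ id]) auto

section \<open>Copies through prescribed vertices and edges\<close>

locale copy_model =
  fixes H :: "'a ugraph" and n :: nat
  assumes simple_H: "simple_graph H" and nonempty_H: "verts H \<noteq> {}"
    and no_isolated_H: "no_isolated_vertices H" and card_le_n: "card (verts H) \<le> n"
begin

definition h :: nat where "h = card (verts H)"

definition m :: nat where "m = m1 H n"

definition copies_at :: "nat \<Rightarrow> nat ugraph set" where
  "copies_at v = {C \<in> copies H n. v \<in> verts C}"

lemma finite_H: "finite (verts H)"
  using simple_H by (simp add: simple_graph_def)

lemma finite_copies_at [simp]: "finite (copies_at v)"
  unfolding copies_at_def using finite_copies[of H n] by simp

lemma copy_simple: "C \<in> copies H n \<Longrightarrow> simple_graph C"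
  and copy_verts: "C \<in> copies H n \<Longrightarrow> verts C \<subseteq> {1..n}"
  by (auto simp: copies_def subgraph_complete_graph_iff)

lemma copy_finite: "C \<in> copies H n \<Longrightarrow> finite (verts C)"
  using copy_simple by (simp add: simple_graph_def)

lemma copy_card: "C \<in> copies H n \<Longrightarrow> card (verts C) = h"
  unfolding copies_def graph_isomorphic_def h_def by (auto dest: bij_betw_same_card)

lemma copy_edge: "C \<in> copies H n \<Longrightarrow> e \<in> edges C \<Longrightarrow> e \<subseteq> verts C \<and> card e = 2"
  using copy_simple[of C] by (simp add: simple_graph_def)

lemma card_2_other:
  assumes "card e = 2" "v \<in> e"
  obtains w where "e = {v, w}" "w \<noteq> v"
  using assms by (auto simp: card_2_iff)

lemma h_ge_2: "h \<ge> 2"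
proof -
  obtain v e where v: "v \<in> verts H" "e \<in> edges H" "v \<in> e"
    using nonempty_H no_isolated_H unfolding no_isolated_vertices_def by blast
  then have "e \<subseteq> verts H" "card e = 2" using simple_H by (auto simp: simple_graph_def)
  then show ?thesis using finite_H card_mono unfolding h_def by metis
qed

lemma n_ge_2: "n \<ge> 2"
  using h_ge_2 card_le_n unfolding h_def by simp

lemma copy_neighbour:
  assumes C: "C \<in> copies H n" and v: "v \<in> verts C"
  obtains w where "w \<in> verts C" "w \<noteq> v" "{v, w} \<in> edges C"
proof -
  obtain f where f: "bij_betw f (verts H) (verts C)"
    "\<And>u v. u \<in> verts H \<Longrightarrow> v \<in> verts H \<Longrightarrow> {u, v} \<in> edges H \<longleftrightarrow> {f u, f v} \<in> edges C"
    using C unfolding copies_def graph_isomorphic_def by blast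
  obtain u where u: "u \<in> verts H" "v = f u" using f(1) v by (auto simp: bij_betw_def)
  obtain e where e: "e \<in> edges H" "u \<in> e"
    using no_isolated_H u unfolding no_isolated_vertices_def by blast
  have e2: "e \<subseteq> verts H" "card e = 2" using e simple_H by (auto simp: simple_graph_def)
  obtain w where w: "e = {u, w}" using card_2_other[OF e2(2) e(2)] by metis
  then have "{v, f w} \<in> edges C" using f(2)[of u w] u e e2 by auto
  moreover from this have "f w \<in> verts C" "f w \<noteq> v" using copy_edge[OF C] by force+
  ultimately show ?thesis using that by blast
qed

lemma copies_nonempty: "copies H n \<noteq> {}"
proof -
  obtain f where "inj_on f (verts H)" "f ` verts H \<subseteq> {1..n}"
    using card_le_inj[OF finite_H, of "{1..n}"] card_le_n by auto
  then have "relabel f H \<in> copies H n"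
    using relabel_in_copies[OF simple_H graph_isomorphic_refl] by blast
  then show ?thesis by blast
qed

lemma relabel_transpose_copies:
  assumes "a \<in> {1..n}" "b \<in> {1..n}" "C \<in> copies H n"
  shows "relabel (Transposition.transpose a b) C \<in> copies H n"
proof (rule relabel_in_copies)
  show "graph_isomorphic H C" using assms(3) by (simp add: copies_def)
  show "Transposition.transpose a b ` verts C \<subseteq> {1..n}"
    using copy_verts[OF assms(3)] assms(1,2) by (auto simp: Transposition.transpose_def)
qed (use copy_simple assms in \<open>auto intro: inj_on_subset[OF inj_transpose]\<close>)

lemma relabel_transpose_involutory: "relabel (Transposition.transpose a b) (relabel (Transposition.transpose a b) C) = C"
proof -
  have "Transposition.transpose a b ` Transposition.transpose a b ` X = X" for X
    by (simp add: image_comp)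
  then show ?thesis unfolding relabel_def by (simp add: image_image)
qed

text \<open>All symmetry between vertices enters here: relabelling by a transposition is an
  involution on the copies.\<close>

lemma card_copies_transpose:
  assumes "a \<in> {1..n}" "b \<in> {1..n}"
    and PQ: "\<And>C. C \<in> copies H n \<Longrightarrow> Q C \<longleftrightarrow> P (relabel (Transposition.transpose a b) C)"
  shows "card {C \<in> copies H n. P C} = card {C \<in> copies H n. Q C}"
proof -
  have "bij_betw (relabel (Transposition.transpose a b)) {C \<in> copies H n. Q C} {C \<in> copies H n. P C}"
  proof (rule bij_betw_byWitness[where f' = "relabel (Transposition.transpose a b)"])
    let ?r = "relabel (Transposition.transpose a b) :: nat ugraph \<Rightarrow> _"
    show "?r ` {C \<in> copies H n. Q C} \<subseteq> {C \<in> copies H n. P C}"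
      using relabel_transpose_copies[OF assms(1,2)] PQ by blast
    show "?r ` {C \<in> copies H n. P C} \<subseteq> {C \<in> copies H n. Q C}"
    proof (rule image_subsetI)
      fix C assume "C \<in> {C \<in> copies H n. P C}"
      then show "?r C \<in> {C \<in> copies H n. Q C}"
        using relabel_transpose_copies[OF assms(1,2)] PQ[of "?r C"]
        by (simp add: relabel_transpose_involutory)
    qed
  qed (simp_all add: relabel_transpose_involutory)
  then show ?thesis by (auto dest: bij_betw_same_card)
qed

lemma mem_verts_relabel: "v \<in> verts (relabel (Transposition.transpose a b) C) \<longleftrightarrow> Transposition.transpose a b v \<in> verts C"
  unfolding relabel_def by (auto intro: image_eqI[of _ _ "Transposition.transpose a b v"])

lemma card_copies_at:
  assumes "v \<in> {1..n}"
  shows "card (copies_at v) = m"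
proof -
  have "1 \<in> {1..n}" using n_ge_2 by simp
  then show ?thesis unfolding copies_at_def m_def m1_def
    by (intro card_copies_transpose[of v 1]) (use assms in \<open>auto simp: mem_verts_relabel\<close>)
qed

lemma card_copies_total: "card (copies H n) * h = n * m"
proof -
  have "card (copies H n) * h = (\<Sum>C\<in>copies H n. card {v \<in> {1..n}. v \<in> verts C})"
  proof -
    have "{v \<in> {1..n}. v \<in> verts C} = verts C" if "C \<in> copies H n" for C
      using copy_verts[OF that] by auto
    then have "(\<Sum>C\<in>copies H n. card {v \<in> {1..n}. v \<in> verts C}) = (\<Sum>C\<in>copies H n. h)"
      by (intro sum.cong) (auto simp: copy_card)
    then show ?thesis by simp
  qed
  also have "\<dots> = (\<Sum>v\<in>{1..n}. card (copies_at v))"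
    unfolding copies_at_def by (rule sum_card_swap) (auto simp: finite_copies)
  also have "\<dots> = n * m" by (simp add: card_copies_at)
  finally show ?thesis .
qed

lemma m_pos: "m > 0"
proof -
  have "card (copies H n) * h > 0"
    using copies_nonempty finite_copies[of H n] h_ge_2 by (simp add: card_gt_0_iff)
  then show ?thesis unfolding card_copies_total by simp
qed

text \<open>Count pairs of a copy at \<open>u\<close> and a second vertex of it; by symmetry every
  second vertex has the same share. The product form avoids division of naturals.\<close>

lemma card_copies_at_pair:
  assumes u: "u \<in> {1..n}" and v: "v \<in> {1..n}" "v \<noteq> u"
  shows "card (copies_at u \<inter> copies_at v) * (n - 1) = m * (h - 1)"
proof -
  have eq: "card (copies_at u \<inter> copies_at w) = card (copies_at u \<inter> copies_at v)"
    if w: "w \<in> {1..n}" "w \<noteq> u" for w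
  proof -
    have "card {C \<in> copies H n. u \<in> verts C \<and> w \<in> verts C}
        = card {C \<in> copies H n. u \<in> verts C \<and> v \<in> verts C}"
      by (rule card_copies_transpose[of v w]) (use v w in \<open>auto simp: mem_verts_relabel\<close>)
    moreover have "copies_at u \<inter> copies_at w = {C \<in> copies H n. u \<in> verts C \<and> w \<in> verts C}" for w
      unfolding copies_at_def by auto
    ultimately show ?thesis by simp
  qed
  have "m * (h - 1) = (\<Sum>C\<in>copies_at u. card {w \<in> {1..n} - {u}. w \<in> verts C})"
  proof -
    have "card {w \<in> {1..n} - {u}. w \<in> verts C} = h - 1" if "C \<in> copies_at u" for C
    proof -
      have C: "C \<in> copies H n" "u \<in> verts C" using that by (auto simp: copies_at_def)
      have "{w \<in> {1..n} - {u}. w \<in> verts C} = verts C - {u}" using copy_verts[OF C(1)] by auto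
      then show ?thesis using C copy_card copy_finite by simp
    qed
    then have "(\<Sum>C\<in>copies_at u. card {w \<in> {1..n} - {u}. w \<in> verts C}) = (\<Sum>C\<in>copies_at u. h - 1)"
      by (intro sum.cong) auto
    then show ?thesis using card_copies_at[OF u] by simp
  qed
  also have "\<dots> = (\<Sum>w\<in>{1..n} - {u}. card {C \<in> copies_at u. w \<in> verts C})"
    by (rule sum_card_swap) auto
  also have "\<dots> = (\<Sum>w\<in>{1..n} - {u}. card (copies_at u \<inter> copies_at v))"
  proof (intro sum.cong refl)
    fix w assume "w \<in> {1..n} - {u}"
    moreover have "{C \<in> copies_at u. w \<in> verts C} = copies_at u \<inter> copies_at w"
      unfolding copies_at_def by auto
    ultimately show "card {C \<in> copies_at u. w \<in> verts C} = card (copies_at u \<inter> copies_at v)"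
      using eq by simp
  qed
  also have "\<dots> = card (copies_at u \<inter> copies_at v) * (n - 1)" using u by simp
  finally show ?thesis by simp
qed

text \<open>Every copy at \<open>u\<close> has an edge at \<open>u\<close>, since \<open>H\<close>
  has no isolated vertices, and by symmetry all other endpoints occur equally often. It is an
  inequality because \<open>u\<close> may have larger degree in the copy.\<close>

lemma card_copies_edge:
  assumes u: "u \<in> {1..n}" and v: "v \<in> {1..n}" "v \<noteq> u"
  shows "card {C \<in> copies H n. {u, v} \<in> edges C} * (n - 1) \<ge> m"
proof -
  have eq: "card {C \<in> copies H n. {u, w} \<in> edges C} = card {C \<in> copies H n. {u, v} \<in> edges C}"
    if w: "w \<in> {1..n}" "w \<noteq> u" for w
  proof (rule card_copies_transpose[of v w])
    fix C :: "nat ugraph"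
    assume C: "C \<in> copies H n"
    let ?t = "Transposition.transpose v w"
    have "{u, w} \<in> edges (relabel ?t C) \<longleftrightarrow> ?t ` {u, w} \<in> edges C"
    proof
      assume "{u, w} \<in> edges (relabel ?t C)"
      then obtain e where e: "e \<in> edges C" "{u, w} = ?t ` e" by (auto simp: relabel_def)
      have "?t ` {u, w} = e" unfolding e(2) by (simp add: image_comp)
      then show "?t ` {u, w} \<in> edges C" using e(1) by simp
    next
      assume "?t ` {u, w} \<in> edges C"
      then have "?t ` ?t ` {u, w} \<in> edges (relabel ?t C)" unfolding relabel_def snd_conv by (rule imageI)
      moreover have "?t ` ?t ` {u, w} = {u, w}" unfolding image_comp by simp
      ultimately show "{u, w} \<in> edges (relabel ?t C)" by simp
    qed
    moreover have "?t ` {u, w} = {u, v}" using v w by simp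
    ultimately show "{u, v} \<in> edges C \<longleftrightarrow> {u, w} \<in> edges (relabel ?t C)" by simp
  qed (use v w in auto)
  have "m = (\<Sum>C\<in>copies_at u. 1)" using card_copies_at[OF u] by simp
  also have "\<dots> \<le> (\<Sum>C\<in>copies_at u. card {w \<in> {1..n} - {u}. {u, w} \<in> edges C})"
  proof (rule sum_mono)
    fix C assume "C \<in> copies_at u"
    then have C: "C \<in> copies H n" "u \<in> verts C" by (auto simp: copies_at_def)
    obtain w where "w \<in> verts C" "w \<noteq> u" "{u, w} \<in> edges C" using copy_neighbour[OF C] .
    then have "{w} \<subseteq> {w \<in> {1..n} - {u}. {u, w} \<in> edges C}" using copy_verts[OF C(1)] by auto
    then have "card {w} \<le> card {w \<in> {1..n} - {u}. {u, w} \<in> edges C}" by (intro card_mono) auto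
    then show "1 \<le> card {w \<in> {1..n} - {u}. {u, w} \<in> edges C}" by simp
  qed
  also have "\<dots> = (\<Sum>w\<in>{1..n} - {u}. card {C \<in> copies_at u. {u, w} \<in> edges C})"
    by (rule sum_card_swap) auto
  also have "\<dots> = (\<Sum>w\<in>{1..n} - {u}. card {C \<in> copies H n. {u, v} \<in> edges C})"
  proof (intro sum.cong refl)
    fix w assume "w \<in> {1..n} - {u}"
    moreover have "{C \<in> copies_at u. {u, w} \<in> edges C} = {C \<in> copies H n. {u, w} \<in> edges C}"
      using copy_edge unfolding copies_at_def by blast
    ultimately show "card {C \<in> copies_at u. {u, w} \<in> edges C} = card {C \<in> copies H n. {u, v} \<in> edges C}"
      using eq by simp
  qed
  also have "\<dots> = card {C \<in> copies H n. {u, v} \<in> edges C} * (n - 1)" using u by simp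
  finally show ?thesis .
qed

text \<open>The right-hand side of the identity for pairs is positive, so some copy contains both
  \<open>1\<close> and \<open>2\<close>. The linear growth of \<open>m\<close> is what makes
  \<open>p\<close> small once \<open>p * m\<close> is logarithmic.\<close>

lemma m_lower: "n - 1 \<le> m * (h - 1)"
proof -
  have 12: "1 \<in> {1..n}" "2 \<in> {1..n}" "2 \<noteq> (1::nat)" using n_ge_2 by auto
  note eq = card_copies_at_pair[OF this]
  have "m * (h - 1) > 0" using m_pos h_ge_2 by simp
  then have "card (copies_at 1 \<inter> copies_at 2) > 0" using eq gr0I by fastforce
  then have "1 * (n - 1) \<le> card (copies_at 1 \<inter> copies_at 2) * (n - 1)" 
    by (intro mult_right_mono) auto
  then show ?thesis unfolding eq by simp
qed

end

section \<open>Deterministic conditions for a perfect matching\<close>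

text \<open>Cut out the loop between two equal entries. Distinctness matters for probabilities: only
  \<open>k\<close> distinct copies are included with probability \<open>p ^ k\<close>.\<close>

lemma successively_distinct:
  assumes "successively R l" "l \<noteq> []"
  shows "\<exists>l'. distinct l' \<and> l' \<noteq> [] \<and> hd l' = hd l \<and> last l' = last l \<and> set l' \<subseteq> set l
    \<and> length l' \<le> length l \<and> successively R l'"
  using assms
proof (induction "length l" arbitrary: l rule: less_induct)
  case less
  show ?case
  proof (cases "distinct l")
    case True
    then show ?thesis using less.prems by (intro exI[of _ l]) auto
  next
    case False
    then obtain xs ys zs y where l: "l = xs @ [y] @ ys @ [y] @ zs"
      using not_distinct_decomp by blast
    let ?k = "xs @ [y] @ zs"
    have "successively R ?k"
      using less.prems(1) unfolding l by (auto simp: successively_append_iff successively_Cons)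
    then obtain l' where l': "distinct l' \<and> l' \<noteq> [] \<and> hd l' = hd ?k \<and> last l' = last ?k \<and> set l' \<subseteq> set ?k
        \<and> length l' \<le> length ?k \<and> successively R l'"
      using less.hyps[of ?k] unfolding l by auto
    have "hd ?k = hd l" "last ?k = last l" unfolding l by (cases xs; simp)+
    then show ?thesis using l' unfolding l by (intro exI[of _ l']) auto
  qed
qed

text \<open>The factor four is spent thus: two for neighbours of \<open>S2\<close> among
  \<open>S1\<close> and its partners, one for partners that lie in \<open>S2\<close>, one for
  \<open>S2\<close> itself.\<close>

lemma expansion_Un:
  assumes fin: "finite S1" "finite S2" "S1 \<inter> S2 = {}" "finite (neighbours E (S1 \<union> S2))"
    and f: "\<And>v. v \<in> S1 \<Longrightarrow> {v, f v} \<in> E" "inj_on f S1" "f ` S1 \<inter> S1 = {}"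
    and few: "\<And>w. w \<in> S2 \<Longrightarrow> card {y \<in> S1 \<union> f ` S1. {w, y} \<in> E} \<le> 2"
    and many: "4 * card S2 \<le> card (neighbours E S2)"
  shows "card (S1 \<union> S2) \<le> card (neighbours E (S1 \<union> S2))"
proof -
  let ?F = "S1 \<union> f ` S1"
  define B where "B = (\<Union>w\<in>S2. {y \<in> ?F. {w, y} \<in> E})"
  have "card B \<le> (\<Sum>w\<in>S2. card {y \<in> ?F. {w, y} \<in> E})"
    unfolding B_def using fin by (intro card_UN_le)
  also have "\<dots> \<le> (\<Sum>w\<in>S2. 2)" using few by (rule sum_mono)
  finally have B: "card B \<le> 2 * card S2" by simp
  have "neighbours E S2 - B \<subseteq> neighbours E (S1 \<union> S2)" "(neighbours E S2 - B) \<inter> f ` S1 = {}"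
    unfolding neighbours_def B_def by blast+
  moreover have "f ` S1 - S2 \<subseteq> neighbours E (S1 \<union> S2)"
    using f unfolding neighbours_def by blast
  ultimately have "card (neighbours E S2 - B) + card (f ` S1 - S2) \<le> card (neighbours E (S1 \<union> S2))"
    using fin by (subst card_Un_disjoint[symmetric]) (auto intro!: card_mono intro: finite_subset)
  moreover have "finite B" using fin finite_subset[of B ?F] unfolding B_def by auto
  then have "card (neighbours E S2) - card B \<le> card (neighbours E S2 - B)"
    by (rule diff_card_le_card_Diff)
  moreover have "card (f ` S1) - card S2 \<le> card (f ` S1 - S2)"
    using fin by (intro diff_card_le_card_Diff)
  moreover have "card (f ` S1) = card S1" using f by (intro card_image)
  moreover have "card (S1 \<union> S2) = card S1 + card S2" using fin by (intro card_Un_disjoint)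
  ultimately show ?thesis using many B by linarith
qed

section \<open>Expansion deduced from properties of the included copies\<close>

context copy_model
begin

definition included :: "(nat ugraph \<Rightarrow> bool) \<Rightarrow> nat ugraph set" where
  "included \<omega> = {C \<in> copies H n. \<omega> C}"

definition union_edges :: "(nat ugraph \<Rightarrow> bool) \<Rightarrow> nat set set" where
  "union_edges \<omega> = (\<Union>C\<in>included \<omega>. edges C)"

text \<open>
  If every vertex of \<open>S\<close> lies in \<open>50h\<close> included copies and \<open>|N(S)| < 4|S|\<close>, then at least \<open>50|S|\<close>
  included copies meet the set \<open>S \<union> N(S)\<close>, of size below \<open>5|S|\<close>, twice; hence the constants \<open>50\<close>,
  \<open>10\<close> and \<open>5\<close> below.
\<close>

definition low :: "(nat ugraph \<Rightarrow> bool) \<Rightarrow> nat \<Rightarrow> bool" where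
  "low \<omega> v \<longleftrightarrow> card {C \<in> copies_at v. \<omega> C} < 50 * h"

abbreviation meets :: "nat ugraph \<Rightarrow> nat ugraph \<Rightarrow> bool" where
  "meets C D \<equiv> verts C \<inter> verts D \<noteq> {}"

text \<open>Lists of copies rather than paths of vertices, because the union bound runs over chains
  of copies.\<close>

definition near :: "(nat ugraph \<Rightarrow> bool) \<Rightarrow> nat \<Rightarrow> nat \<Rightarrow> nat \<Rightarrow> bool" where
  "near \<omega> k u v \<longleftrightarrow> (\<exists>l. l \<noteq> [] \<and> length l \<le> k \<and> successively meets l \<and> set l \<subseteq> included \<omega>
      \<and> u \<in> verts (hd l) \<and> v \<in> verts (last l))"

lemma finite_included: "finite (included \<omega>)"
  unfolding included_def using finite_copies[of H n] by simp

lemma near_mono: "near \<omega> j u v \<Longrightarrow> j \<le> k \<Longrightarrow> near \<omega> k u v"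
  unfolding near_def using le_trans by blast

lemma near_trans:
  assumes "near \<omega> j u v" "near \<omega> k v w"
  shows "near \<omega> (j + k) u w"
proof -
  obtain l l' where "l \<noteq> []" "length l \<le> j" "successively meets l" "set l \<subseteq> included \<omega>"
    "u \<in> verts (hd l)" "v \<in> verts (last l)" "l' \<noteq> []" "length l' \<le> k" "successively meets l'"
    "set l' \<subseteq> included \<omega>" "v \<in> verts (hd l')" "w \<in> verts (last l')"
    using assms unfolding near_def by blast
  then show ?thesis unfolding near_def
    by (intro exI[of _ "l @ l'"]) (auto simp: successively_append_iff)
qed

lemma near_edge:
  assumes "{u, v} \<in> union_edges \<omega>"
  shows "near \<omega> 1 u v" and "u \<in> {1..n}" and "v \<in> {1..n}" and "u \<noteq> v"
proof -
  obtain C where C: "C \<in> copies H n" "\<omega> C" "{u, v} \<in> edges C"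
    using assms unfolding union_edges_def included_def by blast
  then have uv: "u \<in> verts C" "v \<in> verts C" "card {u, v} = 2" using copy_edge by blast+
  then show "u \<in> {1..n}" "v \<in> {1..n}" "u \<noteq> v" using copy_verts[OF C(1)] by auto
  show "near \<omega> 1 u v" unfolding near_def
    using uv C by (intro exI[of _ "[C]"]) (auto simp: included_def)
qed

lemma finite_edges_union: "finite_edges (union_edges \<omega>)"
proof
  show "card e = 2" if "e \<in> union_edges \<omega>" for e
    using that copy_edge unfolding union_edges_def included_def by blast
  have "union_edges \<omega> \<subseteq> Pow {1..n}"
    using copy_edge copy_verts unfolding union_edges_def included_def by blast
  then show "finite (union_edges \<omega>)" using finite_subset by blast
qed

lemma neighbours_subset: "neighbours (union_edges \<omega>) S \<subseteq> {1..n}"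
  unfolding neighbours_def using near_edge(3) by blast

lemma included_neighbour:
  assumes "C \<in> included \<omega>" "v \<in> verts C"
  obtains w where "w \<in> verts C" "w \<noteq> v" "{v, w} \<in> union_edges \<omega>"
proof -
  have "C \<in> copies H n" using assms(1) unfolding included_def by simp
  then obtain w where "w \<in> verts C" "w \<noteq> v" "{v, w} \<in> edges C"
    by (rule copy_neighbour[OF _ assms(2)])
  then show ?thesis using that[of w] assms(1) unfolding union_edges_def by simp blast
qed

definition all_covered :: "(nat ugraph \<Rightarrow> bool) \<Rightarrow> bool" where
  "all_covered \<omega> \<longleftrightarrow> (\<forall>v\<in>{1..n}. \<exists>C\<in>copies_at v. \<omega> C)"

text \<open>Why four: a vertex adjacent to a low vertex or to the chosen neighbour of one is within
  two copies of that low vertex, so two low vertices seen in this way are within four.\<close>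

definition low_separated :: "(nat ugraph \<Rightarrow> bool) \<Rightarrow> bool" where
  "low_separated \<omega> \<longleftrightarrow> (\<forall>u v. near \<omega> 4 u v \<longrightarrow> low \<omega> u \<longrightarrow> low \<omega> v \<longrightarrow> u = v)"

definition locally_sparse :: "real \<Rightarrow> (nat ugraph \<Rightarrow> bool) \<Rightarrow> bool" where
  "locally_sparse t \<omega> \<longleftrightarrow> (\<forall>U\<subseteq>{1..n}. U \<noteq> {} \<longrightarrow> real (card U) \<le> 5 * t \<longrightarrow>
     card {C \<in> included \<omega>. 2 \<le> card (verts C \<inter> U)} < 10 * card U)"

text \<open>Such a copy contains a neighbour of \<open>v\<close> outside
  \<open>S \<union> T\<close>, so including it prevents \<open>T\<close> from containing all
  neighbours of \<open>S\<close>.\<close>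

definition escaping :: "nat set \<Rightarrow> nat set \<Rightarrow> nat ugraph set" where
  "escaping S T = {C \<in> copies H n. \<exists>v\<in>S. verts C \<inter> (S \<union> T) = {v}}"

definition medium_expanding :: "real \<Rightarrow> real \<Rightarrow> (nat ugraph \<Rightarrow> bool) \<Rightarrow> bool" where
  "medium_expanding t b \<omega> \<longleftrightarrow> (\<forall>S\<subseteq>{1..n}. \<forall>T\<subseteq>{1..n}. card T = card S \<longrightarrow> t < real (card S) \<longrightarrow>
     real (card S) \<le> 3 * b \<longrightarrow> (\<exists>C\<in>escaping S T. \<omega> C))"

definition crossing :: "nat set \<Rightarrow> nat set \<Rightarrow> nat ugraph set" where
  "crossing A B = {C \<in> copies H n. \<exists>x\<in>A. \<exists>y\<in>B. {x, y} \<in> edges C}"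

definition large_joined :: "real \<Rightarrow> (nat ugraph \<Rightarrow> bool) \<Rightarrow> bool" where
  "large_joined b \<omega> \<longleftrightarrow> (\<forall>A\<subseteq>{1..n}. \<forall>B\<subseteq>{1..n}. A \<inter> B = {} \<longrightarrow> b \<le> real (card A) \<longrightarrow>
     b \<le> real (card B) \<longrightarrow> (\<exists>C\<in>crossing A B. \<omega> C))"

lemma medium_expansion:
  assumes "medium_expanding t b \<omega>" "S \<subseteq> {1..n}" "t < real (card S)" "real (card S) \<le> 3 * b"
  shows "card S \<le> card (neighbours (union_edges \<omega>) S)"
proof (rule ccontr)
  let ?N = "neighbours (union_edges \<omega>) S"
  assume "\<not> ?thesis"
  then have "card ?N \<le> card S" by simp
  moreover have "card S \<le> card {1..n}" using assms(2) by (intro card_mono) auto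
  \<comment> \<open>Padding to size exactly \<open>card S\<close> leaves (n choose s)^2 pairs for
    the union bound. \<open>T\<close> may overlap \<open>S\<close>, so there is always room.\<close>
  ultimately obtain T where T: "?N \<subseteq> T" "T \<subseteq> {1..n}" "card T = card S"
    using exists_subset_between[of ?N "card S" "{1..n}"] neighbours_subset by auto
  then obtain C where C: "C \<in> escaping S T" "\<omega> C"
    using assms unfolding medium_expanding_def by blast
  then obtain v where v: "v \<in> S" "verts C \<inter> (S \<union> T) = {v}" and CC: "C \<in> included \<omega>"
    unfolding escaping_def included_def by blast
  then have "v \<in> verts C" by blast
  from included_neighbour[OF CC this]
  obtain w where w: "w \<in> verts C" "w \<noteq> v" "{v, w} \<in> union_edges \<omega>" .
  then have "w \<in> S \<or> w \<in> ?N" unfolding neighbours_def using v by blast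
  then show False using T v w by blast
qed

lemma high_expansion:
  assumes sparse: "locally_sparse t \<omega>" and S: "S \<subseteq> {1..n}" "real (card S) \<le> t"
    and high: "\<And>v. v \<in> S \<Longrightarrow> \<not> low \<omega> v"
  shows "4 * card S \<le> card (neighbours (union_edges \<omega>) S)"
proof (cases "S = {}")
  case False
  show ?thesis
  proof (rule ccontr)
    let ?N = "neighbours (union_edges \<omega>) S"
    define U where "U = S \<union> ?N"
    define R where "R = {C \<in> included \<omega>. verts C \<inter> S \<noteq> {}}"
    assume "\<not> ?thesis"
    then have N: "card ?N < 4 * card S" by simp
    have fS: "finite S" using S finite_subset by blast
    have U: "U \<subseteq> {1..n}" unfolding U_def using S neighbours_subset by blast
    have cU: "card U < 5 * card S" unfolding U_def using N card_Un_le[of S ?N] by linarith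
    have fR: "finite R" unfolding R_def using finite_included by simp
    have "50 * h * card S = (\<Sum>v\<in>S. 50 * h)" by simp
    also have "\<dots> \<le> (\<Sum>v\<in>S. card {C \<in> R. v \<in> verts C})"
    proof (rule sum_mono)
      fix v assume v: "v \<in> S"
      then have "{C \<in> copies_at v. \<omega> C} = {C \<in> R. v \<in> verts C}"
        unfolding R_def copies_at_def included_def by blast
      then show "50 * h \<le> card {C \<in> R. v \<in> verts C}" using high[OF v] unfolding low_def by simp
    qed
    also have "\<dots> = (\<Sum>C\<in>R. card {v \<in> S. v \<in> verts C})" by (rule sum_card_swap[OF fS fR])
    \<comment> \<open>A copy is counted at most \<open>h\<close> times, which is absorbed by the
      factor \<open>h\<close> in \<open>low\<close>.\<close>
    also have "\<dots> \<le> (\<Sum>C\<in>R. h)"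
    proof (rule sum_mono)
      fix C assume "C \<in> R"
      then have C: "C \<in> copies H n" unfolding R_def included_def by blast
      have "card {v \<in> S. v \<in> verts C} \<le> card (verts C)" using copy_finite[OF C] by (intro card_mono) auto
      then show "card {v \<in> S. v \<in> verts C} \<le> h" using copy_card[OF C] by simp
    qed
    finally have "h * (50 * card S) \<le> h * card R" by (simp add: mult_ac)
    then have "50 * card S \<le> card R" using h_ge_2 by simp
    also have "card R \<le> card {C \<in> included \<omega>. 2 \<le> card (verts C \<inter> U)}"
    proof (intro card_mono subsetI)
      fix C assume "C \<in> R"
      then obtain v where C: "C \<in> included \<omega>" "v \<in> verts C" "v \<in> S" unfolding R_def by blast
      obtain w where w: "w \<in> verts C" "w \<noteq> v" "{v, w} \<in> union_edges \<omega>"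
        using included_neighbour[OF C(1,2)] .
      then have "{v, w} \<subseteq> verts C \<inter> U" unfolding U_def neighbours_def using C by blast
      moreover have "finite (verts C \<inter> U)" using U finite_subset by blast
      ultimately have "card {v, w} \<le> card (verts C \<inter> U)" by (intro card_mono)
      then show "C \<in> {C \<in> included \<omega>. 2 \<le> card (verts C \<inter> U)}" using w C by simp
    qed (use finite_included in simp)
    also have "\<dots> < 10 * card U"
      using sparse U False cU S(2) unfolding locally_sparse_def U_def by auto
    finally show False using cU by simp
  qed
qed simp

text \<open>Separation makes the chosen neighbours \<open>f v\<close> of low vertices distinct and
  not themselves in \<open>S1\<close>, and lets a vertex of \<open>S2\<close> see at most one pair
  \<open>v\<close>, \<open>f v\<close>. With \<open>high_expansion\<close> for \<open>S2\<close>,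
  this is the input of \<open>expansion_Un\<close>.\<close>

lemma small_expansion:
  assumes cov: "all_covered \<omega>" and sep: "low_separated \<omega>" and sparse: "locally_sparse t \<omega>"
    and S: "S \<subseteq> {1..n}" "real (card S) \<le> t"
  shows "card S \<le> card (neighbours (union_edges \<omega>) S)"
proof -
  let ?E = "union_edges \<omega>"
  define S1 where "S1 = {v \<in> S. low \<omega> v}"
  define S2 where "S2 = {v \<in> S. \<not> low \<omega> v}"
  have fS: "finite S" using S finite_subset by blast
  have S12: "S = S1 \<union> S2" "S1 \<inter> S2 = {}" "finite S1" "finite S2"
    using fS unfolding S1_def S2_def by auto
  have "\<exists>w. {v, w} \<in> ?E" if "v \<in> S1" for v
  proof -
    have "v \<in> {1..n}" using that S unfolding S1_def by blast
    then obtain C where "C \<in> included \<omega>" "v \<in> verts C"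
      using cov unfolding all_covered_def copies_at_def included_def by blast
    then obtain w where "{v, w} \<in> ?E" by (rule included_neighbour)
    then show ?thesis ..
  qed
  then obtain f where f: "\<And>v. v \<in> S1 \<Longrightarrow> {v, f v} \<in> ?E" by metis
  have comm: "{a, b} \<in> ?E \<Longrightarrow> {b, a} \<in> ?E" for a b by (simp add: insert_commute)
  have sep': "u = v" if "near \<omega> k u v" "k \<le> 4" "u \<in> S1" "v \<in> S1" for u v k
    using that near_mono sep unfolding low_separated_def S1_def by blast
  have step: "near \<omega> 1 v (f v)" "near \<omega> 1 (f v) v" if "v \<in> S1" for v
    using f[OF that] comm near_edge(1) by blast+
  have "inj_on f S1"
  proof (rule inj_onI)
    fix u v assume uv: "u \<in> S1" "v \<in> S1" "f u = f v"
    have "near \<omega> (1 + 1) u v" using near_trans[OF step(1)[OF uv(1)]] step(2)[OF uv(2)] uv(3) by simp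
    from sep'[OF this] uv show "u = v" by simp
  qed
  moreover have "f ` S1 \<inter> S1 = {}"
  proof (rule ccontr)
    assume "f ` S1 \<inter> S1 \<noteq> {}"
    then obtain v where v: "v \<in> S1" "f v \<in> S1" by blast
    then have "v = f v" using sep'[OF step(1)[OF v(1)]] by simp
    then show False using near_edge(4)[OF f[OF v(1)]] by simp
  qed
  moreover have "card {y \<in> S1 \<union> f ` S1. {w, y} \<in> ?E} \<le> 2" if "w \<in> S2" for w
  proof (cases "{y \<in> S1 \<union> f ` S1. {w, y} \<in> ?E} = {}")
    case False
    define near2 where "near2 = (\<lambda>v. near \<omega> 2 w v \<and> near \<omega> 2 v w)"
    have two: "\<exists>v\<in>S1. near2 v \<and> y \<in> {v, f v}" if y: "y \<in> S1 \<union> f ` S1" "{w, y} \<in> ?E" for y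
    proof -
      obtain v where v: "v \<in> S1" "y = v \<or> y = f v" using y by blast
      have wy: "near \<omega> 1 w y" "near \<omega> 1 y w" using near_edge(1) y(2) comm by blast+
      from v(2) have "near2 v"
      proof
        assume "y = v"
        then show ?thesis using wy near_mono[of \<omega> 1] unfolding near2_def by simp
      next
        assume y: "y = f v"
        show ?thesis
          using near_trans[OF wy(1)] near_trans[OF _ wy(2)] step[OF v(1)]
          unfolding near2_def y by (metis one_add_one)
      qed
      then show ?thesis using v by blast
    qed
    obtain y where "y \<in> S1 \<union> f ` S1" "{w, y} \<in> ?E" using False by blast
    then obtain v where v: "v \<in> S1" "near2 v" using two by blast
    have "v' = v" if "v' \<in> S1" "near2 v'" for v'
      using near_trans[of \<omega> 2 v' w 2 v] sep'[of 4 v' v] that v unfolding near2_def by simp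
    then have "{y \<in> S1 \<union> f ` S1. {w, y} \<in> ?E} \<subseteq> {v, f v}" using two by blast
    then have "card {y \<in> S1 \<union> f ` S1. {w, y} \<in> ?E} \<le> card {v, f v}" by (intro card_mono) auto
    also have "\<dots> \<le> 2" by (simp add: card_insert_if)
    finally show ?thesis .
  next
    case True
    then show ?thesis by (metis card.empty zero_le)
  qed
  moreover have "4 * card S2 \<le> card (neighbours ?E S2)"
  proof (rule high_expansion[OF sparse])
    have "card S2 \<le> card S" using fS by (intro card_mono) (auto simp: S2_def)
    then show "real (card S2) \<le> t" using S(2) by linarith
  qed (use S in \<open>auto simp: S2_def\<close>)
  moreover have "finite (neighbours ?E (S1 \<union> S2))" using neighbours_subset finite_subset by blast
  ultimately show ?thesis unfolding S12(1)
    using expansion_Un[OF S12(3,4,2), of ?E f] f by blast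
qed

lemma perfect_matching_iff:
  "has_perfect_matching (V, E) \<longleftrightarrow> (\<exists>M\<subseteq>E. \<forall>v\<in>V. \<exists>!e. e \<in> M \<and> v \<in> e)"
  by (simp add: has_perfect_matching_def perfect_matching_def)

lemma has_perfect_matchingI:
  assumes "even n" "b > 0" and "all_covered \<omega>" "low_separated \<omega>" "locally_sparse t \<omega>"
    and "medium_expanding t b \<omega>" "large_joined b \<omega>"
  shows "has_perfect_matching ({1..n}, union_edges \<omega>)"
proof -
  let ?E = "union_edges \<omega>"
  interpret finite_edges ?E by (rule finite_edges_union)
  have "\<exists>M. is_matching ?E M \<and> \<Union>M = {1..n}"
  proof (rule expander_perfect_matching)
    show "\<Union>?E \<subseteq> {1..n}"
      using copy_edge copy_verts unfolding union_edges_def included_def by blast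
    show "card S \<le> card (neighbours ?E S)"
      if "S \<subseteq> {1..n}" "S \<noteq> {}" "real (card S) \<le> 3 * b" for S
      using small_expansion[OF assms(3,4,5) that(1)] medium_expansion[OF assms(6) that(1) _ that(3)]
      by linarith
    show "\<exists>x\<in>A. \<exists>y\<in>B. {x, y} \<in> ?E"
      if AB: "A \<subseteq> {1..n}" "B \<subseteq> {1..n}" "A \<inter> B = {}" "b \<le> real (card A)" "b \<le> real (card B)" for A B
    proof -
      obtain C where "C \<in> crossing A B" "\<omega> C"
        using assms(7)[unfolded large_joined_def, rule_format, OF AB] by (elim bexE)
      then show ?thesis unfolding crossing_def union_edges_def included_def by blast
    qed
  qed (use assms(1,2) in simp_all)
  then obtain M where M: "is_matching ?E M" "\<Union>M = {1..n}" by blast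
  have "\<exists>!e. e \<in> M \<and> v \<in> e" if "v \<in> {1..n}" for v
  proof (rule ex_ex1I)
    have "v \<in> \<Union>M" using that M(2) by simp
    then show "\<exists>e. e \<in> M \<and> v \<in> e" by blast
    show "e = f" if "e \<in> M \<and> v \<in> e" "f \<in> M \<and> v \<in> f" for e f
      using is_matching_eq[OF M(1), of e f v] that by simp
  qed
  moreover have "M \<subseteq> ?E" using M(1) is_matching_subset by blast
  ultimately show ?thesis unfolding perfect_matching_iff by (intro exI[of _ M] conjI ballI)
qed

end

section \<open>Probabilities of the conditions\<close>

lemma prob_le_sum:
  assumes "finite I" "A \<subseteq> (\<Union>i\<in>I. B i)" "\<And>i. i \<in> I \<Longrightarrow> measure_pmf.prob M (B i) \<le> c i"
  shows "measure_pmf.prob M A \<le> (\<Sum>i\<in>I. c i)"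
proof -
  have "measure_pmf.prob M A \<le> measure_pmf.prob M (\<Union>i\<in>I. B i)"
    using assms(2) by (intro measure_pmf.finite_measure_mono) auto
  also have "\<dots> \<le> (\<Sum>i\<in>I. measure_pmf.prob M (B i))"
    using assms(1) by (intro measure_pmf.finite_measure_subadditive_finite) auto
  also have "\<dots> \<le> (\<Sum>i\<in>I. c i)" using assms(3) by (rule sum_mono)
  finally show ?thesis .
qed

lemma power_one_minus_le_exp:
  fixes x y :: real
  assumes "0 \<le> x" "x \<le> 1" "y \<le> real k"
  shows "(1 - x) ^ k \<le> exp (- (x * y))"
proof -
  have "(1 - x) ^ k \<le> exp (- x) ^ k"
    using assms exp_ge_add_one_self[of "- x"] by (intro power_mono) auto
  also have "\<dots> = exp (- (x * real k))" by (simp add: exp_of_nat_mult[symmetric] mult.commute)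
  also have "\<dots> \<le> exp (- (x * y))" using assms by (simp add: mult_left_mono)
  finally show ?thesis .
qed

context copy_model
begin

text \<open>The vertices \<open>1\<close> and \<open>2\<close> stand for an arbitrary pair, by
  \<open>card_pair\<close>.\<close>

definition m2 :: nat where "m2 = card (copies_at 1 \<inter> copies_at 2)"

lemma m2_eq: "m2 * (n - 1) = m * (h - 1)"
  unfolding m2_def using card_copies_at_pair[of 1 2] n_ge_2 by simp

lemma card_pair:
  assumes "u \<in> {1..n}" "v \<in> {1..n}" "u \<noteq> v"
  shows "card (copies_at u \<inter> copies_at v) = m2"
proof -
  have "card (copies_at u \<inter> copies_at v) * (n - 1) = m2 * (n - 1)"
    using card_copies_at_pair[of u v] assms m2_eq by simp
  then show ?thesis using n_ge_2 by simp
qed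

lemma m2_le: "real m2 \<le> 2 * h * m / n"
proof -
  have n: "real n \<ge> 2" using n_ge_2 by simp
  have "real m2 * (real n - 1) = m * (real h - 1)"
    using arg_cong[OF m2_eq, of real] n_ge_2 h_ge_2 by (simp add: of_nat_diff)
  also have "\<dots> \<le> real m * h" by (simp add: algebra_simps)
  finally have "real m2 * (real n - 1) \<le> real m * h" .
  moreover have "real m2 * (real n / 2) \<le> real m2 * (real n - 1)"
    using n by (intro mult_left_mono) auto
  ultimately show ?thesis using n by (simp add: field_simps)
qed

lemma m_ge: "real n \<le> 2 * h * m"
proof -
  have "n - 1 \<le> m * h" using m_lower h_ge_2 by (metis diff_le_self le_trans mult_le_mono2)
  then have "n \<le> m * h + 1" by linarith
  moreover have "1 * 1 \<le> m * h" using m_pos h_ge_2 by (intro mult_mono) auto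
  ultimately have "n \<le> 2 * (m * h)" by linarith
  then have "n \<le> 2 * h * m" by (simp add: mult_ac)
  then show ?thesis by (rule of_nat_mono)
qed

definition random_inclusion :: "real \<Rightarrow> (nat ugraph \<Rightarrow> bool) pmf" where
  "random_inclusion p = Pi_pmf (copies H n) False (\<lambda>_. bernoulli_pmf p)"

lemma prob_random_copies_graph:
  "measure_pmf.prob (random_copies_graph H n p) {G. P G}
    = measure_pmf.prob (random_inclusion p) {\<omega>. P ({1..n}, union_edges \<omega>)}"
  unfolding random_copies_graph_def random_inclusion_def union_edges_def included_def
  by (simp add: vimage_def)

lemma copies_at_subset: "copies_at v \<subseteq> copies H n"
  unfolding copies_at_def by blast

section \<open>Coverage and separation of low vertices\<close>

context
  fixes p :: real
  assumes p: "0 \<le> p" "p \<le> 1"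
begin

lemmas prob_none = prob_none_included[OF finite_copies p, of _ H n, folded random_inclusion_def]
lemmas prob_few = prob_few_included[OF finite_copies p, of _ H n, folded random_inclusion_def]
lemmas prob_many = prob_many_included[OF finite_copies p, of _ H n, folded random_inclusion_def]

lemma prob_none_le:
  assumes "Q \<subseteq> copies H n" "y \<le> real (card Q)"
  shows "measure_pmf.prob (random_inclusion p) {\<omega>. \<forall>C\<in>Q. \<not> \<omega> C} \<le> exp (- (p * y))"
  unfolding prob_none[OF assms(1)] using power_one_minus_le_exp p assms(2) by blast

lemma prob_not_covered:
  "measure_pmf.prob (random_inclusion p) {\<omega>. \<not> all_covered \<omega>} \<le> n * exp (- (p * m))"
proof -
  have "measure_pmf.prob (random_inclusion p) {\<omega>. \<not> all_covered \<omega>} \<le> (\<Sum>v\<in>{1..n}. exp (- (p * m)))"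
  proof (rule prob_le_sum)
    show "{\<omega>. \<not> all_covered \<omega>} \<subseteq> (\<Union>v\<in>{1..n}. {\<omega>. \<forall>C\<in>copies_at v. \<not> \<omega> C})"
      unfolding all_covered_def by blast
    show "measure_pmf.prob (random_inclusion p) {\<omega>. \<forall>C\<in>copies_at v. \<not> \<omega> C} \<le> exp (- (p * m))"
      if "v \<in> {1..n}" for v
      using prob_none_le[OF copies_at_subset, of m v] card_copies_at[OF that] by simp
  qed simp
  then show ?thesis by simp
qed

definition chains :: "nat \<Rightarrow> nat ugraph list set" where
  "chains k = {l. length l = Suc k \<and> set l \<subseteq> copies H n \<and> successively meets l}"

text \<open>A copy put in front meets the head in one of its \<open>h\<close> vertices, and each
  vertex lies in \<open>m\<close> copies.\<close>

lemma card_chains: "finite (chains k) \<and> card (chains k) \<le> card (copies H n) * (h * m) ^ k"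
proof (induction k)
  case 0
  have "chains 0 = (\<lambda>C. [C]) ` copies H n"
    unfolding chains_def by (auto simp: length_Suc_conv)
  then show ?case using finite_copies[of H n] by (simp add: card_image inj_on_def)
next
  case (Suc k)
  define X where "X = (\<lambda>l. (\<lambda>C. C # l) ` (\<Union>v\<in>verts (hd l). copies_at v))"
  have sub: "chains (Suc k) \<subseteq> (\<Union>l\<in>chains k. X l)"
  proof
    fix l' assume "l' \<in> chains (Suc k)"
    then obtain C l where l: "l' = C # l" "length l = Suc k" "C \<in> copies H n" "set l \<subseteq> copies H n"
      "successively meets (C # l)"
      unfolding chains_def by (auto simp: length_Suc_conv)
    then have "l \<noteq> []" by auto
    then have "meets C (hd l)" "successively meets l" using l(5) by (auto simp: successively_Cons)
    then show "l' \<in> (\<Union>l\<in>chains k. X l)"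
      using l unfolding chains_def X_def copies_at_def by blast
  qed
  have X: "finite (X l) \<and> card (X l) \<le> h * m" if "l \<in> chains k" for l
  proof -
    have "hd l \<in> copies H n" using that unfolding chains_def by (cases l) auto
    note C = copy_finite[OF this] copy_card[OF this] copy_verts[OF this]
    have "card (\<Union>v\<in>verts (hd l). copies_at v) \<le> (\<Sum>v\<in>verts (hd l). card (copies_at v))"
      using C by (intro card_UN_le)
    also have "\<dots> = (\<Sum>v\<in>verts (hd l). m)" using C card_copies_at by (intro sum.cong) auto
    also have "\<dots> = h * m" using C by simp
    finally show ?thesis unfolding X_def using C by (auto simp: card_image inj_on_def)
  qed
  have fin: "finite (\<Union>l\<in>chains k. X l)" using Suc X by blast
  have "card (chains (Suc k)) \<le> card (\<Union>l\<in>chains k. X l)" by (intro card_mono fin sub)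
  also have "\<dots> \<le> (\<Sum>l\<in>chains k. card (X l))" using Suc by (intro card_UN_le) auto
  also have "\<dots> \<le> (\<Sum>l\<in>chains k. h * m)" using X by (intro sum_mono) auto
  also have "\<dots> \<le> card (copies H n) * (h * m) ^ k * (h * m)" using Suc by simp
  finally show ?case using fin sub finite_subset by (auto simp: mult_ac)
qed

lemma not_low_separated_chain:
  assumes "\<not> low_separated \<omega>"
  obtains k l u v where "k < 4" "l \<in> chains k" "distinct l" "\<forall>C\<in>set l. \<omega> C"
    "u \<in> (\<Union>C\<in>set l. verts C)" "v \<in> (\<Union>C\<in>set l. verts C)" "u \<noteq> v" "low \<omega> u" "low \<omega> v"
proof -
  obtain u v where uv: "near \<omega> 4 u v" "low \<omega> u" "low \<omega> v" "u \<noteq> v"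
    using assms unfolding low_separated_def by blast
  obtain l0 where l0: "l0 \<noteq> []" "length l0 \<le> 4" "successively meets l0" "set l0 \<subseteq> included \<omega>"
      "u \<in> verts (hd l0)" "v \<in> verts (last l0)"
    using uv(1) unfolding near_def by blast
  obtain l where l: "distinct l" "l \<noteq> []" "hd l = hd l0" "last l = last l0" "set l \<subseteq> set l0"
      "length l \<le> length l0" "successively meets l"
    using successively_distinct[OF l0(3,1)] by blast
  show ?thesis
  proof (rule that)
    show "length l - 1 < 4" using l l0 by (cases l) auto
    show "l \<in> chains (length l - 1)"
      using l l0(4) unfolding chains_def included_def by (cases l) auto
    show "\<forall>C\<in>set l. \<omega> C" using l l0(4) unfolding included_def by blast
    show "u \<in> (\<Union>C\<in>set l. verts C)" using l0(5) l(2,3) hd_in_set[of l] by force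
    show "v \<in> (\<Union>C\<in>set l. verts C)" using l0(6) l(2,4) last_in_set[of l] by force
  qed (use uv l in auto)
qed

text \<open>Union bound over chains of at most four distinct copies and pairs of vertices on them.
  The chain is included, and of the other copies at \<open>u\<close> or \<open>v\<close> at most
  \<open>100 * h\<close> are, twice the limit in \<open>low\<close>; these events involve disjoint
  sets of copies. The \<open>64\<close> combines four chain lengths with the \<open>16\<close> in
  the \<open>(4 * h) ^ 2\<close> pairs.\<close>

lemma prob_not_low_separated:
  fixes l0 :: real
  assumes l0: "0 < l0" "l0 \<le> 1" and L: "1 \<le> p * m"
  shows "measure_pmf.prob (random_inclusion p) {\<omega>. \<not> low_separated \<omega>}
    \<le> 64 * h ^ 2 * (n * (p * m)) * (h * (p * m)) ^ 3
       * (exp (- (p * (1 - l0) * (2 * real m - m2 - 4))) / l0 ^ (100 * h))"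
proof -
  define B where "B = exp (- (p * (1 - l0) * (2 * real m - m2 - 4))) / l0 ^ (100 * h)"
  define W where "W = (\<lambda>l::nat ugraph list. \<Union>C\<in>set l. verts C)"
  define Q where "Q = (\<lambda>l u v. (copies_at u \<union> copies_at v) - set l)"
  define I where "I = (SIGMA k:{..<4}. SIGMA l:{l \<in> chains k. distinct l}. {uv \<in> W l \<times> W l. fst uv \<noteq> snd uv})"
  define ev where "ev = (\<lambda>(k::nat, l, u, v). {\<omega>. (\<forall>C\<in>set l. \<omega> C) \<and> card {C \<in> Q l u v. \<omega> C} \<le> 100 * h})"
  have W: "finite (W l) \<and> card (W l) \<le> 4 * h \<and> W l \<subseteq> {1..n}" if l: "l \<in> chains k" "k < 4" for l k
  proof -
    have sl: "C \<in> copies H n" if "C \<in> set l" for C using l that unfolding chains_def by blast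
    have "card (W l) \<le> (\<Sum>C\<in>set l. card (verts C))" unfolding W_def by (intro card_UN_le) auto
    also have "\<dots> = (\<Sum>C\<in>set l. h)" using sl copy_card by (intro sum.cong) auto
    also have "\<dots> \<le> length l * h" using card_length[of l] by simp
    also have "\<dots> \<le> 4 * h" using l unfolding chains_def by auto
    finally show ?thesis unfolding W_def using sl copy_finite copy_verts by blast
  qed
  have finI: "finite I" unfolding I_def
    using W card_chains by (intro finite_SigmaI) auto
  have sum_le: "(\<Sum>i\<in>I. p ^ Suc (fst i) * B) \<le> (\<Sum>k<4. card (copies H n) * (h * m) ^ k * (4 * h) ^ 2 * (p ^ Suc k * B))"
  proof -
    have B0: "B \<ge> 0" unfolding B_def using l0 by simp
    have "(\<Sum>i\<in>I. p ^ Suc (fst i) * B)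
        = (\<Sum>k<4. real (card (SIGMA l:{l \<in> chains k. distinct l}. {uv \<in> W l \<times> W l. fst uv \<noteq> snd uv})) * (p ^ Suc k * B))"
    proof -
      define Y where "Y = (\<lambda>k. SIGMA l:{l \<in> chains k. distinct l}. {uv \<in> W l \<times> W l. fst uv \<noteq> snd uv})"
      have "finite (Y k)" if "k < 4" for k
        unfolding Y_def using W[OF _ that] card_chains by (intro finite_SigmaI) auto
      then have "(\<Sum>k<4. \<Sum>x\<in>Y k. p ^ Suc k * B) = (\<Sum>(k, x)\<in>(SIGMA k:{..<4}. Y k). p ^ Suc k * B)"
        by (intro sum.Sigma) auto
      then show ?thesis unfolding I_def Y_def split_def by simp
    qed
    also have "\<dots> \<le> (\<Sum>k<4. real (card (copies H n) * (h * m) ^ k * (4 * h) ^ 2) * (p ^ Suc k * B))"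
    proof (intro sum_mono mult_right_mono)
      fix k :: nat assume k: "k \<in> {..<4}"
      let ?S = "SIGMA l:{l \<in> chains k. distinct l}. {uv \<in> W l \<times> W l. fst uv \<noteq> snd uv}"
      have "card ?S = (\<Sum>l\<in>{l \<in> chains k. distinct l}. card {uv \<in> W l \<times> W l. fst uv \<noteq> snd uv})"
        using card_chains W k by (intro card_SigmaI) auto
      also have "\<dots> \<le> (\<Sum>l\<in>{l \<in> chains k. distinct l}. (4 * h) ^ 2)"
      proof (rule sum_mono)
        fix l assume "l \<in> {l \<in> chains k. distinct l}"
        then have w: "finite (W l)" "card (W l) \<le> 4 * h" using W k by auto
        have "card {uv \<in> W l \<times> W l. fst uv \<noteq> snd uv} \<le> card (W l \<times> W l)"
          using w by (intro card_mono) auto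
        also have "\<dots> \<le> (4 * h) ^ 2"
          using w mult_mono[OF w(2) w(2)] by (simp add: card_cartesian_product power2_eq_square)
        finally show "card {uv \<in> W l \<times> W l. fst uv \<noteq> snd uv} \<le> (4 * h) ^ 2" .
      qed
      also have "\<dots> = card {l \<in> chains k. distinct l} * (4 * h) ^ 2" by simp
      also have "\<dots> \<le> card (chains k) * (4 * h) ^ 2"
        using card_chains[of k] by (intro mult_right_mono card_mono) auto
      also have "\<dots> \<le> card (copies H n) * (h * m) ^ k * (4 * h) ^ 2"
        using card_chains by (intro mult_right_mono) auto
      finally show "real (card ?S) \<le> real (card (copies H n) * (h * m) ^ k * (4 * h) ^ 2)"
        by (rule of_nat_mono)
    qed (use p B0 in simp)
    finally show ?thesis by (simp only: of_nat_mult of_nat_power)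
  qed
  have "measure_pmf.prob (random_inclusion p) {\<omega>. \<not> low_separated \<omega>} \<le> (\<Sum>i\<in>I. p ^ Suc (fst i) * B)"
  proof (rule prob_le_sum[OF finI])
    show "{\<omega>. \<not> low_separated \<omega>} \<subseteq> (\<Union>i\<in>I. ev i)"
    proof
      fix \<omega> assume "\<omega> \<in> {\<omega>. \<not> low_separated \<omega>}"
      then have "\<not> low_separated \<omega>" by simp
      then obtain k l u v where kl: "k < 4" "l \<in> chains k" "distinct l" "\<forall>C\<in>set l. \<omega> C"
          "u \<in> W l" "v \<in> W l" "u \<noteq> v" "low \<omega> u" "low \<omega> v"
        unfolding W_def by (rule not_low_separated_chain)
      have "card {C \<in> Q l u v. \<omega> C} \<le> card ({C \<in> copies_at u. \<omega> C} \<union> {C \<in> copies_at v. \<omega> C})"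
        unfolding Q_def by (intro card_mono) auto
      also have "\<dots> \<le> card {C \<in> copies_at u. \<omega> C} + card {C \<in> copies_at v. \<omega> C}" by (rule card_Un_le)
      also have "\<dots> \<le> 100 * h" using kl(8,9) unfolding low_def by simp
      finally have "\<omega> \<in> ev (k, l, u, v)" unfolding ev_def using kl(4) by simp
      moreover have "(k, l, u, v) \<in> I" unfolding I_def using kl by simp
      ultimately show "\<omega> \<in> (\<Union>i\<in>I. ev i)" by (rule UN_I[rotated])
    qed
    fix i assume "i \<in> I"
    then obtain k l u v where i: "i = (k, l, u, v)" and kl: "k < 4" "l \<in> chains k" "distinct l"
      "u \<in> W l" "v \<in> W l" "u \<noteq> v"
      unfolding I_def by auto
    have cl: "card (set l) = Suc k" "set l \<subseteq> copies H n"
      using kl distinct_card[of l] unfolding chains_def by auto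
    have uv: "u \<in> {1..n}" "v \<in> {1..n}" using W[OF kl(2,1)] kl(4,5) by auto
    \<comment> \<open>Copies through both vertices count once, and the chain removes at most
      four.\<close>
    have "card (copies_at u \<union> copies_at v) + m2 = 2 * m"
      using card_Un_Int[of "copies_at u" "copies_at v"] card_pair[OF uv kl(6)] card_copies_at uv by simp
    moreover have "card (copies_at u \<union> copies_at v) - card (set l) \<le> card (Q l u v)"
      unfolding Q_def by (rule diff_card_le_card_Diff) simp
    ultimately have "2 * m \<le> card (Q l u v) + m2 + 4" using cl(1) kl(1) by linarith
    then have Qge: "2 * real m - m2 - 4 \<le> real (card (Q l u v))" by linarith
    have "measure_pmf.prob (random_inclusion p) (ev i)
        \<le> p ^ card (set l) * (1 - p + p * l0) ^ card (Q l u v) / l0 ^ (100 * h)"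
      unfolding ev_def i prod.case
      by (rule prob_few) (use cl l0 copies_at_subset in \<open>auto simp: Q_def\<close>)
    also have "\<dots> = p ^ Suc k * ((1 - p * (1 - l0)) ^ card (Q l u v) / l0 ^ (100 * h))"
      by (simp add: cl algebra_simps)
    also have "\<dots> \<le> p ^ Suc k * B" unfolding B_def
      using p l0 Qge mult_le_one[of p "1 - l0"]
      by (intro mult_left_mono divide_right_mono power_one_minus_le_exp) auto
    finally show "measure_pmf.prob (random_inclusion p) (ev i) \<le> p ^ Suc (fst i) * B" by (simp add: i)
  qed
  also note sum_le
  \<comment> \<open>One factor \<open>p\<close> is paired with the number of copies, each further
    one with a factor \<open>m\<close>.\<close>
  also have "(\<Sum>k<4. card (copies H n) * (h * m) ^ k * (4 * h) ^ 2 * (p ^ Suc k * B))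
      = (\<Sum>k<4. 16 * h ^ 2 * (card (copies H n) * p) * (h * (p * m)) ^ k * B)"
    by (intro sum.cong refl) (simp add: power_mult_distrib mult_ac)
  also have "\<dots> \<le> (\<Sum>k<(4::nat). 16 * h ^ 2 * (n * (p * m)) * (h * (p * m)) ^ 3 * B)"
  proof (rule sum_mono)
    fix k :: nat assume k: "k \<in> {..<4}"
    have "card (copies H n) * 1 \<le> card (copies H n) * h" using h_ge_2 by (intro mult_left_mono) auto
    then have "real (card (copies H n)) \<le> real (n * m)"
      unfolding card_copies_total by (metis of_nat_mono mult_1_right)
    then have "real (card (copies H n)) * p \<le> real (n * m) * p" using p by (intro mult_right_mono)
    then have c: "real (card (copies H n)) * p \<le> n * (p * m)" by (simp add: mult_ac)
    have "1 * 1 \<le> real h * (p * m)" using h_ge_2 L by (intro mult_mono) auto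
    then have d: "(h * (p * m)) ^ k \<le> (h * (p * m)) ^ 3" using k by (intro power_increasing) auto
    have "B \<ge> 0" unfolding B_def using l0 by simp
    then show "16 * h ^ 2 * (card (copies H n) * p) * (h * (p * m)) ^ k * B
        \<le> 16 * h ^ 2 * (n * (p * m)) * (h * (p * m)) ^ 3 * B"
      using p by (intro mult_right_mono[OF mult_mono[OF mult_left_mono[OF c] d]]) auto
  qed
  also have "\<dots> = 64 * h ^ 2 * (n * (p * m)) * (h * (p * m)) ^ 3 * B" by simp
  finally show ?thesis unfolding B_def .
qed

end

end


section \<open>Local sparsity, medium sets and large sets\<close>

context copy_model
begin

context
  fixes p :: real
  assumes p: "0 \<le> p" "p \<le> 1"
begin

definition meeting_twice :: "nat set \<Rightarrow> nat ugraph set" where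
  "meeting_twice U = {C \<in> copies H n. 2 \<le> card (verts C \<inter> U)}"

lemma card_meeting_twice:
  assumes U: "U \<subseteq> {1..n}"
  shows "card (meeting_twice U) \<le> card U ^ 2 * m2"
proof -
  define P where "P = {uv \<in> U \<times> U. fst uv \<noteq> snd uv}"
  have fU: "finite U" using U finite_subset by blast
  have "meeting_twice U \<subseteq> (\<Union>uv\<in>P. copies_at (fst uv) \<inter> copies_at (snd uv))"
  proof
    fix C assume "C \<in> meeting_twice U"
    then have C: "C \<in> copies H n" "2 \<le> card (verts C \<inter> U)" unfolding meeting_twice_def by auto
    then obtain u v where "u \<in> verts C \<inter> U" "v \<in> verts C \<inter> U" "u \<noteq> v"
      by (metis card_le_Suc0_iff_eq Suc_1 not_less_eq_eq card.infinite zero_le numeral_2_eq_2 not_numeral_le_zero)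
    then have "(u, v) \<in> P" "C \<in> copies_at (fst (u, v)) \<inter> copies_at (snd (u, v))"
      using C unfolding P_def copies_at_def by auto
    then show "C \<in> (\<Union>uv\<in>P. copies_at (fst uv) \<inter> copies_at (snd uv))" by (rule UN_I)
  qed
  then have "card (meeting_twice U) \<le> card (\<Union>uv\<in>P. copies_at (fst uv) \<inter> copies_at (snd uv))"
    using fU unfolding P_def by (intro card_mono) auto
  also have "\<dots> \<le> (\<Sum>uv\<in>P. card (copies_at (fst uv) \<inter> copies_at (snd uv)))"
    using fU unfolding P_def by (intro card_UN_le) auto
  also have "\<dots> = (\<Sum>uv\<in>P. m2)"
  proof (intro sum.cong refl)
    fix uv assume "uv \<in> P"
    then have "fst uv \<in> U" "snd uv \<in> U" "fst uv \<noteq> snd uv" unfolding P_def by auto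
    then show "card (copies_at (fst uv) \<inter> copies_at (snd uv)) = m2"
      using card_pair subsetD[OF U] by metis
  qed
  also have "\<dots> \<le> card (U \<times> U) * m2"
  proof -
    have "card P \<le> card (U \<times> U)" using fU unfolding P_def by (intro card_mono) auto
    then show ?thesis by simp
  qed
  also have "\<dots> = card U ^ 2 * m2" by (simp add: card_cartesian_product power2_eq_square)
  finally show ?thesis .
qed

text \<open>By \<open>small\<close>, the exponential moment for a set of \<open>u\<close> vertices
  is at most exp u. The bound for size \<open>u\<close> is then \<open>q ^ u\<close> with
  \<open>q = n * exp 1 / l ^ 10\<close>, hence at most \<open>q\<close>, and there are at most
  \<open>n\<close> sizes.\<close>

lemma prob_not_locally_sparse:
  fixes l t :: real
  assumes l: "1 \<le> l" and small: "p * l * (5 * t) * m2 \<le> 1" and q: "n * exp 1 / l ^ 10 \<le> 1"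
  shows "measure_pmf.prob (random_inclusion p) {\<omega>. \<not> locally_sparse t \<omega>} \<le> n * (n * exp 1 / l ^ 10)"
proof -
  define q where "q = n * exp 1 / l ^ 10"
  define Us where "Us = (\<lambda>u. {U. U \<subseteq> {1..n} \<and> card U = u})"
  define J where "J = {u \<in> {1..n}. real u \<le> 5 * t}"
  have q0: "0 \<le> q" "q \<le> 1" unfolding q_def using l q by auto
  have fUs: "finite (Us u)" for u unfolding Us_def by simp
  have single: "measure_pmf.prob (random_inclusion p) {\<omega>. 10 * card U \<le> card {C \<in> meeting_twice U. \<omega> C}}
      \<le> exp u / l ^ (10 * u)" if "u \<in> J" "U \<in> Us u" for u U
  proof -
    have U: "U \<subseteq> {1..n}" "card U = u" "real u \<le> 5 * t" using that unfolding J_def Us_def by auto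
    have "measure_pmf.prob (random_inclusion p) {\<omega>. 10 * card U \<le> card {C \<in> meeting_twice U. \<omega> C}}
      \<le> (1 - p + p * l) ^ card (meeting_twice U) / l ^ (10 * u)"
      unfolding U(2) by (rule prob_many[OF p _ l]) (auto simp: meeting_twice_def)
    also have "(1 - p + p * l) ^ card (meeting_twice U) \<le> exp (p * l) ^ card (meeting_twice U)"
    proof (rule power_mono)
      have "1 - p + p * l \<le> 1 + p * l" using p by simp
      also have "\<dots> \<le> exp (p * l)" by (rule exp_ge_add_one_self)
      finally show "1 - p + p * l \<le> exp (p * l)" .
    qed (use p l in simp)
    also have "\<dots> = exp (p * l * card (meeting_twice U))"
      by (simp add: exp_of_nat_mult[symmetric] mult.commute)
    also have "\<dots> \<le> exp u"
    proof -
      have "real (card (meeting_twice U)) \<le> real (u ^ 2 * m2)"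
        using card_meeting_twice[OF U(1)] U(2) by (intro of_nat_mono) simp
      then have "p * l * card (meeting_twice U) \<le> p * l * real (u ^ 2 * m2)"
        using p l by (intro mult_left_mono) auto
      also have "\<dots> = u * (p * l * u * m2)" by (simp add: power2_eq_square)
      also have "\<dots> \<le> u * (p * l * (5 * t) * m2)"
        using p l U(3) by (intro mult_left_mono mult_right_mono) auto
      also have "\<dots> \<le> real u * (1::real)" using small by (intro mult_left_mono) auto
      finally show ?thesis by simp
    qed
    finally show ?thesis using l by (simp add: divide_right_mono)
  qed
  have "measure_pmf.prob (random_inclusion p) {\<omega>. \<not> locally_sparse t \<omega>} \<le> (\<Sum>u\<in>J. q)"
  proof (rule prob_le_sum)
    show "finite J" unfolding J_def by simp
    show "{\<omega>. \<not> locally_sparse t \<omega>}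
        \<subseteq> (\<Union>u\<in>J. \<Union>U\<in>Us u. {\<omega>. 10 * card U \<le> card {C \<in> meeting_twice U. \<omega> C}})"
    proof
      fix \<omega> assume "\<omega> \<in> {\<omega>. \<not> locally_sparse t \<omega>}"
      then obtain U where U: "U \<subseteq> {1..n}" "U \<noteq> {}" "real (card U) \<le> 5 * t"
          "10 * card U \<le> card {C \<in> included \<omega>. 2 \<le> card (verts C \<inter> U)}"
        unfolding locally_sparse_def by (auto simp: not_less)
      have "{C \<in> included \<omega>. 2 \<le> card (verts C \<inter> U)} = {C \<in> meeting_twice U. \<omega> C}"
        unfolding included_def meeting_twice_def by auto
      moreover have "card U \<in> J" unfolding J_def
        using U card_mono[OF _ U(1)] finite_subset[OF U(1)] by (simp add: Suc_le_eq card_gt_0_iff)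
      ultimately show "\<omega> \<in> (\<Union>u\<in>J. \<Union>U\<in>Us u. {\<omega>. 10 * card U \<le> card {C \<in> meeting_twice U. \<omega> C}})"
        using U unfolding Us_def by (intro UN_I[of "card U"] UN_I[of U]) auto
    qed
    fix u assume u: "u \<in> J"
    have "measure_pmf.prob (random_inclusion p) (\<Union>U\<in>Us u. {\<omega>. 10 * card U \<le> card {C \<in> meeting_twice U. \<omega> C}})
        \<le> (\<Sum>U\<in>Us u. exp u / l ^ (10 * u))"
      by (rule prob_le_sum[OF fUs order_refl]) (use single u in blast)
    also have "\<dots> = real (n choose u) * (exp u / l ^ (10 * u))"
      unfolding Us_def using n_subsets[of "{1..n}" u] by simp
    also have "\<dots> \<le> real (n ^ u) * (exp u / l ^ (10 * u))"
      using binomial_le_pow[of u n] u l unfolding J_def by (intro mult_right_mono of_nat_mono) auto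
    also have "\<dots> = q ^ u"
      unfolding q_def by (simp add: power_mult_distrib power_divide power_mult[symmetric] exp_of_nat_mult[symmetric])
    also have "\<dots> \<le> q ^ 1" using q0 u unfolding J_def by (intro power_decreasing) auto
    finally show "measure_pmf.prob (random_inclusion p)
        (\<Union>U\<in>Us u. {\<omega>. 10 * card U \<le> card {C \<in> meeting_twice U. \<omega> C}}) \<le> q" by simp
  qed
  also have "\<dots> = card J * q" by simp
  also have "\<dots> \<le> n * q"
  proof -
    have "card J \<le> card {1..n}" unfolding J_def by (intro card_mono) auto
    then show ?thesis using q0 by (intro mult_right_mono of_nat_mono) auto
  qed
  finally show ?thesis unfolding q_def .
qed

text \<open>From the \<open>m\<close> copies at each \<open>v \<in> S\<close> discard those through
  another vertex of \<open>S \<union> T\<close>, at most \<open>m2\<close> for each of fewer than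
  \<open>2 * card S\<close> vertices. The survivors at different \<open>v\<close> are different
  copies. The bracket is real and may be negative.\<close>

lemma card_escaping:
  assumes S: "S \<subseteq> {1..n}" and T: "T \<subseteq> {1..n}" "card T = card S"
  shows "card S * (real m - 2 * card S * m2) \<le> card (escaping S T)"
proof -
  define X where "X = (\<lambda>v. copies_at v - (\<Union>w\<in>(S \<union> T) - {v}. copies_at v \<inter> copies_at w))"
  have fin: "finite S" "finite T" using S T finite_subset by blast+
  have X: "real m - 2 * card S * m2 \<le> card (X v)" if v: "v \<in> S" for v
  proof -
    have "card (\<Union>w\<in>(S \<union> T) - {v}. copies_at v \<inter> copies_at w)
        \<le> (\<Sum>w\<in>(S \<union> T) - {v}. card (copies_at v \<inter> copies_at w))"
      using fin by (intro card_UN_le) auto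
    also have "\<dots> = (\<Sum>w\<in>(S \<union> T) - {v}. m2)"
      using S T v by (intro sum.cong refl card_pair) blast+
    also have "\<dots> \<le> card (S \<union> T) * m2" using fin by (auto intro: mult_right_mono card_Diff1_le)
    also have "\<dots> \<le> (2 * card S) * m2" using card_Un_le[of S T] T(2) by (intro mult_right_mono) auto
    finally have "card (\<Union>w\<in>(S \<union> T) - {v}. copies_at v \<inter> copies_at w) \<le> 2 * card S * m2" .
    moreover have "card (copies_at v) - card (\<Union>w\<in>(S \<union> T) - {v}. copies_at v \<inter> copies_at w) \<le> card (X v)"
      unfolding X_def using fin by (intro diff_card_le_card_Diff) auto
    moreover have "card (copies_at v) = m" using S v by (intro card_copies_at) auto
    ultimately have "m \<le> card (X v) + 2 * card S * m2" by linarith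
    then have "real m \<le> real (card (X v) + 2 * card S * m2)" by (rule of_nat_mono)
    then show ?thesis by simp
  qed
  have "card S * (real m - 2 * card S * m2) = (\<Sum>v\<in>S. real m - 2 * card S * m2)" by simp
  also have "\<dots> \<le> (\<Sum>v\<in>S. real (card (X v)))" using X by (rule sum_mono)
  also have "\<dots> = real (card (\<Union>v\<in>S. X v))"
  proof -
    have "X v \<inter> X w = {}" if "v \<in> S" "w \<in> S" "v \<noteq> w" for v w
      using that unfolding X_def by blast
    then show ?thesis using fin by (subst card_UN_disjoint) (auto simp: X_def)
  qed
  also have "\<dots> \<le> card (escaping S T)"
  proof (intro of_nat_mono card_mono)
    show "finite (escaping S T)" unfolding escaping_def using finite_copies[of H n] by simp
    show "(\<Union>v\<in>S. X v) \<subseteq> escaping S T"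
      unfolding X_def escaping_def copies_at_def by auto
  qed
  finally show ?thesis .
qed

lemma prob_not_medium_expanding:
  fixes t b :: real
  assumes t: "0 \<le> t"
  shows "measure_pmf.prob (random_inclusion p) {\<omega>. \<not> medium_expanding t b \<omega>}
    \<le> (\<Sum>s | s \<in> {1..n} \<and> t < s \<and> real s \<le> 3 * b. (real (n choose s))\<^sup>2 * exp (- (p * (s * (real m - 2 * s * m2)))))"
proof (rule prob_le_sum)
  let ?J = "{s. s \<in> {1..n} \<and> t < s \<and> real s \<le> 3 * b}"
  define Ss where "Ss = (\<lambda>s. {S. S \<subseteq> {1..n} \<and> card S = s})"
  define ev where "ev = (\<lambda>(S, T). {\<omega>. \<forall>C\<in>escaping S T. \<not> \<omega> C})"
  show "finite ?J" by simp
  show "{\<omega>. \<not> medium_expanding t b \<omega>} \<subseteq> (\<Union>s\<in>?J. \<Union>ST\<in>Ss s \<times> Ss s. ev ST)"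
  proof
    fix \<omega> assume "\<omega> \<in> {\<omega>. \<not> medium_expanding t b \<omega>}"
    then obtain S T where ST: "S \<subseteq> {1..n}" "T \<subseteq> {1..n}" "card T = card S" "t < real (card S)"
      "real (card S) \<le> 3 * b" "\<forall>C\<in>escaping S T. \<not> \<omega> C"
      unfolding medium_expanding_def by auto
    have "card S \<le> n" using card_mono[OF _ ST(1)] by simp
    moreover have "1 \<le> card S" using ST(4) t by linarith
    ultimately have "card S \<in> ?J" using ST by simp
    moreover have "(S, T) \<in> Ss (card S) \<times> Ss (card S)" unfolding Ss_def using ST by simp
    moreover have "\<omega> \<in> ev (S, T)" unfolding ev_def using ST by simp
    ultimately show "\<omega> \<in> (\<Union>s\<in>?J. \<Union>ST\<in>Ss s \<times> Ss s. ev ST)" by blast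
  qed
  fix s assume s: "s \<in> ?J"
  have "measure_pmf.prob (random_inclusion p) (\<Union>ST\<in>Ss s \<times> Ss s. ev ST)
      \<le> (\<Sum>ST\<in>Ss s \<times> Ss s. exp (- (p * (s * (real m - 2 * s * m2)))))"
  proof (rule prob_le_sum[OF _ order_refl])
    show "finite (Ss s \<times> Ss s)" unfolding Ss_def by simp
    fix ST assume "ST \<in> Ss s \<times> Ss s"
    then obtain S T where ST: "ST = (S, T)" "S \<subseteq> {1..n}" "T \<subseteq> {1..n}" "card S = s" "card T = s"
      unfolding Ss_def by auto
    have "s * (real m - 2 * s * m2) \<le> card (escaping S T)"
      using card_escaping[OF ST(2,3)] ST(4,5) by simp
    then show "measure_pmf.prob (random_inclusion p) (ev ST) \<le> exp (- (p * (s * (real m - 2 * s * m2))))"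
      unfolding ev_def ST(1) prod.case by (rule prob_none_le[OF p, rotated]) (auto simp: escaping_def)
  qed
  also have "\<dots> = (real (n choose s))\<^sup>2 * exp (- (p * (s * (real m - 2 * s * m2))))"
    unfolding Ss_def using n_subsets[of "{1..n}" s] by (simp add: card_cartesian_product power2_eq_square)
  finally show "measure_pmf.prob (random_inclusion p) (\<Union>ST\<in>Ss s \<times> Ss s. ev ST)
      \<le> (real (n choose s))\<^sup>2 * exp (- (p * (s * (real m - 2 * s * m2))))" .
qed

text \<open>Each pair in \<open>A \<times> B\<close> is an edge of at least \<open>m / n\<close>
  copies, and one copy serves at most \<open>h ^ 2\<close> pairs.\<close>

lemma card_crossing:
  assumes A: "A \<subseteq> {1..n}" and B: "B \<subseteq> {1..n}" and AB: "A \<inter> B = {}"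
  shows "card A * card B * real m / (n * h ^ 2) \<le> card (crossing A B)"
proof -
  have fin: "finite A" "finite B" using A B finite_subset by blast+
  have fc: "finite (crossing A B)" unfolding crossing_def using finite_copies[of H n] by simp
  have "real m / n \<le> card {C \<in> crossing A B. {fst xy, snd xy} \<in> edges C}" if xy: "xy \<in> A \<times> B" for xy
  proof -
    have eq: "{C \<in> crossing A B. {fst xy, snd xy} \<in> edges C} = {C \<in> copies H n. {fst xy, snd xy} \<in> edges C}"
      using mem_Times_iff[THEN iffD1, OF xy] unfolding crossing_def by blast
    have "m \<le> card {C \<in> crossing A B. {fst xy, snd xy} \<in> edges C} * (n - 1)"
    proof -
      have mem: "fst xy \<in> A" "snd xy \<in> B" using xy by auto
      then have "snd xy \<noteq> fst xy" using AB by (metis IntI empty_iff)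
      with subsetD[OF A mem(1)] subsetD[OF B mem(2)] have "m \<le> card {C \<in> copies H n. {fst xy, snd xy} \<in> edges C} * (n - 1)"
        by (rule card_copies_edge)
      then show ?thesis unfolding eq .
    qed
    also have "\<dots> \<le> card {C \<in> crossing A B. {fst xy, snd xy} \<in> edges C} * n" by (intro mult_left_mono) auto
    finally have "real m \<le> card {C \<in> crossing A B. {fst xy, snd xy} \<in> edges C} * real n"
      unfolding of_nat_mult[symmetric] by (rule of_nat_mono)
    then show ?thesis using n_ge_2 by (simp add: pos_divide_le_eq)
  qed
  then have "(\<Sum>xy\<in>A \<times> B. real m / n) \<le> (\<Sum>xy\<in>A \<times> B. real (card {C \<in> crossing A B. {fst xy, snd xy} \<in> edges C}))"
    by (rule sum_mono)
  also have "\<dots> = real (\<Sum>C\<in>crossing A B. card {xy \<in> A \<times> B. {fst xy, snd xy} \<in> edges C})"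
    unfolding of_nat_sum[symmetric] using fin fc by (subst sum_card_swap) auto
  also have "\<dots> \<le> real (\<Sum>C\<in>crossing A B. h ^ 2)"
  proof (intro of_nat_mono sum_mono)
    fix C assume "C \<in> crossing A B"
    then have C: "C \<in> copies H n" unfolding crossing_def by simp
    have "{xy \<in> A \<times> B. {fst xy, snd xy} \<in> edges C} \<subseteq> verts C \<times> verts C"
      using copy_edge[OF C] by (auto dest: copy_edge[OF C])
    then have "card {xy \<in> A \<times> B. {fst xy, snd xy} \<in> edges C} \<le> card (verts C \<times> verts C)"
      using copy_finite[OF C] by (intro card_mono) auto
    then show "card {xy \<in> A \<times> B. {fst xy, snd xy} \<in> edges C} \<le> h ^ 2"
      using copy_card[OF C] by (simp add: card_cartesian_product power2_eq_square)
  qed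
  finally have "card A * card B * (real m / n) \<le> card (crossing A B) * real h ^ 2"
    by (simp add: card_cartesian_product)
  then show ?thesis using h_ge_2 n_ge_2 by (simp add: field_simps)
qed

text \<open>Counting all \<open>4 ^ n\<close> pairs of subsets is affordable: for linear
  \<open>b\<close> and logarithmic \<open>p * m\<close> the exponent has order
  \<open>n * ln n\<close>.\<close>

lemma prob_not_large_joined:
  fixes b :: real
  assumes b: "0 \<le> b"
  shows "measure_pmf.prob (random_inclusion p) {\<omega>. \<not> large_joined b \<omega>}
    \<le> 4 ^ n * exp (- (p * (b\<^sup>2 * m / (n * h ^ 2))))"
proof -
  define J where "J = {(A, B). A \<subseteq> {1..n} \<and> B \<subseteq> {1..n} \<and> A \<inter> B = {} \<and> b \<le> real (card A) \<and> b \<le> real (card B)}"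
  define ev where "ev = (\<lambda>(A, B). {\<omega>. \<forall>C\<in>crossing A B. \<not> \<omega> C})"
  have sub: "J \<subseteq> Pow {1..n} \<times> Pow {1..n}" unfolding J_def by auto
  then have fJ: "finite J" by (rule finite_subset) simp
  have "card J \<le> card (Pow {1..n} \<times> Pow {1..n})" by (rule card_mono[OF _ sub]) simp
  also have "\<dots> = 4 ^ n" by (simp add: card_cartesian_product card_Pow power_mult_distrib[symmetric])
  finally have "real (card J) \<le> real (4 ^ n)" by (rule of_nat_mono)
  then have cJ: "real (card J) \<le> 4 ^ n" by simp
  have "measure_pmf.prob (random_inclusion p) {\<omega>. \<not> large_joined b \<omega>}
      \<le> (\<Sum>AB\<in>J. exp (- (p * (b\<^sup>2 * m / (n * h ^ 2)))))"
  proof (rule prob_le_sum[OF fJ])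
    show "{\<omega>. \<not> large_joined b \<omega>} \<subseteq> (\<Union>AB\<in>J. ev AB)"
    proof
      fix \<omega> assume "\<omega> \<in> {\<omega>. \<not> large_joined b \<omega>}"
      then obtain A B where "(A, B) \<in> J" "\<omega> \<in> ev (A, B)"
        unfolding large_joined_def J_def ev_def by auto
      then show "\<omega> \<in> (\<Union>AB\<in>J. ev AB)" by blast
    qed
    fix AB assume "AB \<in> J"
    then obtain A B where AB: "AB = (A, B)" "A \<subseteq> {1..n}" "B \<subseteq> {1..n}" "A \<inter> B = {}"
      "b \<le> real (card A)" "b \<le> real (card B)" unfolding J_def by auto
    have "b\<^sup>2 * m / (n * h ^ 2) \<le> card A * card B * real m / (n * h ^ 2)"
      unfolding power2_eq_square[of b] using AB b
      by (intro divide_right_mono mult_right_mono) (auto intro: mult_mono)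
    also have "\<dots> \<le> card (crossing A B)" by (rule card_crossing[OF AB(2,3,4)])
    finally show "measure_pmf.prob (random_inclusion p) (ev AB) \<le> exp (- (p * (b\<^sup>2 * m / (n * h ^ 2))))"
      unfolding ev_def AB(1) prod.case by (rule prob_none_le[OF p, rotated]) (auto simp: crossing_def)
  qed
  also have "\<dots> \<le> 4 ^ n * exp (- (p * (b\<^sup>2 * m / (n * h ^ 2))))" using cJ by simp
  finally show ?thesis .
qed

end

end

section \<open>Isolated vertices and the second moment\<close>

lemma power_one_minus_ge_exp:
  fixes x :: real
  assumes "0 \<le> x" "x \<le> 1 / 2"
  shows "exp (- ((x + 2 * x\<^sup>2) * real k)) \<le> (1 - x) ^ k"
proof -
  have "exp (- x - 2 * x\<^sup>2) \<le> exp (ln (1 - x))"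
    using ln_one_minus_pos_lower_bound[OF assms] by simp
  also have "\<dots> = 1 - x" using assms by simp
  finally have "exp (- x - 2 * x\<^sup>2) ^ k \<le> (1 - x) ^ k" by (intro power_mono) auto
  then show ?thesis by (simp add: exp_of_nat_mult[symmetric] algebra_simps)
qed

text \<open>A single term of the exponential series gives s^s \<le> e^s s!.\<close>

lemma binomial_le_exp_power:
  assumes "0 < s" "s \<le> n"
  shows "real (n choose s) \<le> (exp 1 * n / s) ^ s"
proof -
  have "(\<Sum>k\<in>{s}. real s ^ k / fact k) \<le> (\<Sum>k. real s ^ k / fact k)"
    using summable_exp[of "real s"] by (intro sum_le_suminf) (auto simp: field_simps)
  then have "real s ^ s / fact s \<le> exp (real s)"
    by (simp add: exp_def divide_inverse mult.commute scaleR_conv_of_real)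
  then have f: "real s ^ s \<le> exp 1 ^ s * fact s"
    by (simp add: exp_of_nat_mult[symmetric] field_simps)
  have "fact s * (n choose s) \<le> n ^ s" using binomial_fact_pow[of n s] by (simp add: mult.commute)
  then have "real (fact s * (n choose s)) \<le> real (n ^ s)" by (rule of_nat_mono)
  then have "fact s * real (n choose s) \<le> real n ^ s" by simp
  then have "real s ^ s * real (n choose s) \<le> (exp 1 ^ s * fact s) * real (n choose s)"
    using f by (intro mult_right_mono) auto
  also have "\<dots> = exp 1 ^ s * (fact s * real (n choose s))" by (simp add: mult_ac)
  also have "\<dots> \<le> exp 1 ^ s * real n ^ s"
    using \<open>fact s * real (n choose s) \<le> real n ^ s\<close> by (intro mult_left_mono) auto
  finally show ?thesis using assms by (simp add: power_divide power_mult_distrib field_simps)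
qed

context copy_model
begin

definition matchable :: "(nat ugraph \<Rightarrow> bool) \<Rightarrow> bool" where
  "matchable \<omega> \<longleftrightarrow> has_perfect_matching ({1..n}, union_edges \<omega>)"

lemma matchable_covered: "matchable \<omega> \<Longrightarrow> all_covered \<omega>"
  unfolding all_covered_def
proof
  fix v assume m: "matchable \<omega>" and v: "v \<in> {1..n}"
  from m obtain M where M: "M \<subseteq> union_edges \<omega>" "\<forall>v\<in>{1..n}. \<exists>!e. e \<in> M \<and> v \<in> e"
    unfolding matchable_def perfect_matching_iff by (elim exE conjE)
  then obtain e where e: "e \<in> M" "v \<in> e" using v by metis
  then have "e \<in> union_edges \<omega>" using M(1) by auto
  then obtain C where C: "C \<in> included \<omega>" "e \<in> edges C" unfolding union_edges_def by auto
  then have "v \<in> verts C" using copy_edge[of C e] e(2) unfolding included_def by auto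
  then show "\<exists>C\<in>copies_at v. \<omega> C"
    using C(1) by (intro bexI[of _ C]) (auto simp: copies_at_def included_def)
qed

lemma matchable_mono:
  assumes "matchable \<omega>" "\<And>C. \<omega> C \<Longrightarrow> \<omega>' C"
  shows "matchable \<omega>'"
proof -
  have "union_edges \<omega> \<subseteq> union_edges \<omega>'"
    using assms(2) unfolding union_edges_def included_def by auto
  moreover obtain M where M: "M \<subseteq> union_edges \<omega>" "\<forall>v\<in>{1..n}. \<exists>!e. e \<in> M \<and> v \<in> e"
    using assms(1) unfolding matchable_def perfect_matching_iff by (elim exE conjE)
  ultimately show ?thesis unfolding matchable_def perfect_matching_iff
    by (intro exI[of _ M] conjI) auto
qed

lemma prob_matchable_mono:
  assumes "0 \<le> p" "p \<le> q" "q \<le> 1"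
  shows "measure_pmf.prob (random_inclusion p) {\<omega>. matchable \<omega>}
       \<le> measure_pmf.prob (random_inclusion q) {\<omega>. matchable \<omega>}"
  unfolding random_inclusion_def
  by (rule prob_increasing_mono[OF finite_copies assms matchable_mono])

text \<open>Chebyshev for the number of vertices in no included copy, with mean
  \<open>n * q\<close>. The diagonal contributes \<open>1 / (n * q)\<close>; two distinct vertices
  share \<open>m2\<close> copies, so their joint probability is
  \<open>q\<^sup>2 / r\<close>.\<close>

lemma prob_matchable_le:
  fixes p :: real
  assumes p: "0 \<le> p" "p < 1"
  shows "measure_pmf.prob (random_inclusion p) {\<omega>. matchable \<omega>}
     \<le> 1 / (n * (1 - p) ^ m) + 1 / (1 - p) ^ m2 - 1"
proof -
  let ?P = "random_inclusion p"
  have p': "0 \<le> p" "p \<le> 1" using p by auto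
  define I :: "nat \<Rightarrow> (nat ugraph \<Rightarrow> bool) \<Rightarrow> real" where
    "I = (\<lambda>v \<omega>. of_bool (\<forall>C\<in>copies_at v. \<not> \<omega> C))"
  define q where "q = (1 - p) ^ m"
  define r where "r = (1 - p) ^ m2"
  have qr: "q > 0" "r > 0" unfolding q_def r_def using p by auto
  have n: "real n > 0" using n_ge_2 by simp
  define \<mu> where "\<mu> = n * q"
  have \<mu>: "\<mu> > 0" unfolding \<mu>_def using n qr by simp
  have fin: "finite (set_pmf ?P)"
    unfolding random_inclusion_def by (rule finite_set_random_subset[OF finite_copies p'])
  note int = integrable_measure_pmf_finite[OF fin]
  have EI2: "measure_pmf.expectation ?P (\<lambda>\<omega>. I u \<omega> * I v \<omega>) = (1 - p) ^ card (copies_at u \<union> copies_at v)" for u v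
  proof -
    have "I u \<omega> * I v \<omega> = indicator {\<omega>. \<forall>C\<in>copies_at u \<union> copies_at v. \<not> \<omega> C} \<omega>" for \<omega>
      unfolding I_def by (auto simp: indicator_def)
    then have "measure_pmf.expectation ?P (\<lambda>\<omega>. I u \<omega> * I v \<omega>)
        = measure_pmf.prob ?P {\<omega>. \<forall>C\<in>copies_at u \<union> copies_at v. \<not> \<omega> C}" by simp
    also have "\<dots> = (1 - p) ^ card (copies_at u \<union> copies_at v)"
      using copies_at_subset by (intro prob_none[OF p']) auto
    finally show ?thesis .
  qed
  have pair: "(1 - p) ^ card (copies_at u \<union> copies_at v) = q\<^sup>2 / r"
    if "u \<in> {1..n}" "v \<in> {1..n}" "u \<noteq> v" for u v
  proof -
    have "card (copies_at u \<union> copies_at v) + m2 = 2 * m"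
      using card_Un_Int[of "copies_at u" "copies_at v"] card_pair[OF that] card_copies_at that by simp
    then have "(1 - p) ^ (card (copies_at u \<union> copies_at v) + m2) = (1 - p) ^ (2 * m)" by simp
    then have "(1 - p) ^ card (copies_at u \<union> copies_at v) * r = q\<^sup>2"
      unfolding r_def q_def power_add by (simp add: power_mult[symmetric] mult.commute)
    then show ?thesis using qr by (simp add: field_simps)
  qed
  have one: "(1 - p) ^ card (copies_at u \<union> copies_at u) = q" if "u \<in> {1..n}" for u
    unfolding q_def using card_copies_at[OF that] by simp
  have EI: "measure_pmf.expectation ?P (I u) = q" if "u \<in> {1..n}" for u
  proof -
    have "I u = (\<lambda>\<omega>. I u \<omega> * I u \<omega>)" unfolding I_def by (simp only: of_bool_conj[symmetric] simp_thms)
    then show ?thesis using EI2[of u u] one[OF that] by simp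
  qed
  \<comment> \<open>The normalised squared deviation, which equals 1 when every vertex is
    covered.\<close>
  define f where "f = (\<lambda>\<omega>. ((\<Sum>v\<in>{1..n}. I v \<omega>) - \<mu>)\<^sup>2 / \<mu>\<^sup>2)"
  have "measure_pmf.prob ?P {\<omega>. matchable \<omega>} \<le> measure_pmf.expectation ?P f"
  proof (rule measure_pmf_le_expectation[OF fin])
    fix \<omega> assume "\<omega> \<in> {\<omega>. matchable \<omega>}"
    then have "all_covered \<omega>" using matchable_covered by simp
    then have "I v \<omega> = 0" if "v \<in> {1..n}" for v
      using that unfolding I_def all_covered_def by auto
    then have "(\<Sum>v\<in>{1..n}. I v \<omega>) = 0" by (intro sum.neutral) auto
    then show "1 \<le> f \<omega>" unfolding f_def using \<mu> by simp
  qed (auto simp: f_def)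
  also have "measure_pmf.expectation ?P f
      = ((\<Sum>u\<in>{1..n}. \<Sum>v\<in>{1..n}. (1 - p) ^ card (copies_at u \<union> copies_at v)) - 2 * \<mu> * (n * q) + \<mu>\<^sup>2) / \<mu>\<^sup>2"
  proof -
    have "f = (\<lambda>\<omega>. ((\<Sum>u\<in>{1..n}. \<Sum>v\<in>{1..n}. I u \<omega> * I v \<omega>) - 2 * \<mu> * (\<Sum>u\<in>{1..n}. I u \<omega>) + \<mu>\<^sup>2) / \<mu>\<^sup>2)"
      unfolding f_def by (simp add: power2_diff sum_product power2_eq_square algebra_simps)
    then have "measure_pmf.expectation ?P f
       = ((\<Sum>u\<in>{1..n}. \<Sum>v\<in>{1..n}. measure_pmf.expectation ?P (\<lambda>\<omega>. I u \<omega> * I v \<omega>))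
          - 2 * \<mu> * (\<Sum>u\<in>{1..n}. measure_pmf.expectation ?P (I u)) + \<mu>\<^sup>2) / \<mu>\<^sup>2"
      by (simp add: int Bochner_Integration.integral_sum Bochner_Integration.integral_diff
          Bochner_Integration.integral_add)
    then show ?thesis using EI by (simp add: EI2)
  qed
  also have "(\<Sum>u\<in>{1..n}. \<Sum>v\<in>{1..n}. (1 - p) ^ card (copies_at u \<union> copies_at v))
      = (\<Sum>u\<in>{1..n}. q + (real n - 1) * (q\<^sup>2 / r))"
  proof (rule sum.cong[OF refl])
    fix u assume u: "u \<in> {1..n}"
    have "(\<Sum>v\<in>{1..n}. (1 - p) ^ card (copies_at u \<union> copies_at v))
        = q + (\<Sum>v\<in>{1..n} - {u}. (1 - p) ^ card (copies_at u \<union> copies_at v))"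
      using u one[OF u] by (subst sum.remove[of _ u]) auto
    also have "(\<Sum>v\<in>{1..n} - {u}. (1 - p) ^ card (copies_at u \<union> copies_at v)) = (\<Sum>v\<in>{1..n} - {u}. q\<^sup>2 / r)"
      using pair[OF u] by (intro sum.cong) auto
    also have "\<dots> = (real n - 1) * (q\<^sup>2 / r)" using u n_ge_2 by (simp add: of_nat_diff)
    finally show "(\<Sum>v\<in>{1..n}. (1 - p) ^ card (copies_at u \<union> copies_at v)) = q + (real n - 1) * (q\<^sup>2 / r)" .
  qed
  also have "((\<Sum>u\<in>{1..n}. q + (real n - 1) * (q\<^sup>2 / r)) - 2 * \<mu> * (n * q) + \<mu>\<^sup>2) / \<mu>\<^sup>2
      = 1 / (n * q) + (1 - 1 / n) * (1 / r) - 1"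
    unfolding \<mu>_def using n qr by (simp add: field_simps power2_eq_square)
  also have "\<dots> \<le> 1 / (n * q) + 1 / r - 1"
    using n qr by (simp add: divide_right_mono)
  finally show ?thesis unfolding q_def r_def .
qed

lemma p_le:
  fixes p :: real
  shows "0 \<le> p \<Longrightarrow> p \<le> 2 * h * (p * m) / n"
  using mult_left_mono[OF m_ge, of p] n_ge_2 by (simp add: field_simps)

lemma p_m2_le:
  fixes p :: real
  shows "0 \<le> p \<Longrightarrow> p * m2 \<le> 2 * h * (p * m) / n"
  using mult_left_mono[OF m2_le, of p] by (simp add: field_simps)

text \<open>The expected number of uncovered vertices is at least exp x up to the error
  \<open>4 * h * (ln n)\<^sup>2 / n\<close>, which comes from the quadratic term in
  \<open>power_one_minus_ge_exp\<close>.\<close>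

lemma prob_matchable_upper:
  fixes p x :: real
  assumes p: "0 \<le> p" and pm: "p * m \<le> ln n - x" and x: "0 \<le> x"
    and small: "4 * h * ln n / n \<le> 1"
  shows "measure_pmf.prob (random_inclusion p) {\<omega>. matchable \<omega>}
     \<le> exp (- x + 4 * h * (ln n)\<^sup>2 / n) + exp (4 * h * ln n / n) - 1"
proof -
  have n: "real n > 0" using n_ge_2 by simp
  have ln0: "0 \<le> ln (real n)" using n_ge_2 by simp
  have pm': "p * m \<le> ln n" using pm x by linarith
  have pm0: "0 \<le> p * m" using p by simp
  have hb: "2 * h * (p * m) / n \<le> 2 * h * ln n / n"
    using pm' n by (intro divide_right_mono mult_left_mono) auto
  have pb: "p \<le> 2 * h * ln n / n" using p_le[OF p] hb by linarith
  then have half: "p \<le> 1 / 2" using small by simp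
  have pm2: "p * m2 \<le> 2 * h * ln n / n" using p_m2_le[OF p] hb by linarith
  have "1 / (n * (1 - p) ^ m) \<le> exp (- x + 4 * h * (ln n)\<^sup>2 / n)"
  proof -
    have "(p + 2 * p\<^sup>2) * m = p * m + 2 * p * (p * m)" by (simp add: power2_eq_square algebra_simps)
    also have "\<dots> \<le> (ln n - x) + 2 * (2 * h * ln n / n) * ln n"
      using pm pm' pb p pm0 ln0 by (intro add_mono mult_mono) auto
    also have "\<dots> = ln n - x + 4 * h * (ln n)\<^sup>2 / n" by (simp add: power2_eq_square)
    finally have "exp (- (ln n - x + 4 * h * (ln n)\<^sup>2 / n)) \<le> exp (- ((p + 2 * p\<^sup>2) * m))" by simp
    also have "\<dots> \<le> (1 - p) ^ m" by (rule power_one_minus_ge_exp[OF p half])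
    finally have "n * exp (- (ln n - x + 4 * h * (ln n)\<^sup>2 / n)) \<le> n * (1 - p) ^ m"
      using n by simp
    moreover have "n * exp (- (ln n - x + 4 * h * (ln n)\<^sup>2 / n)) = exp (x - 4 * h * (ln n)\<^sup>2 / n)"
    proof -
      have "n * exp (- (ln n - x + 4 * h * (ln n)\<^sup>2 / n)) = exp (ln n) * exp (- (ln n - x + 4 * h * (ln n)\<^sup>2 / n))"
        using n by simp
      also have "\<dots> = exp (x - 4 * h * (ln n)\<^sup>2 / n)" unfolding exp_add[symmetric] by simp
      finally show ?thesis .
    qed
    ultimately have "exp (x - 4 * h * (ln n)\<^sup>2 / n) \<le> n * (1 - p) ^ m" by simp
    then have "1 / (n * (1 - p) ^ m) \<le> 1 / exp (x - 4 * h * (ln n)\<^sup>2 / n)"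
      by (intro divide_left_mono) (use n half in auto)
    also have "\<dots> = exp (- x + 4 * h * (ln n)\<^sup>2 / n)"
      by (simp add: exp_minus[symmetric] inverse_eq_divide[symmetric])
    finally show ?thesis .
  qed
  moreover have "1 / (1 - p) ^ m2 \<le> exp (4 * h * ln n / n)"
  proof -
    have "(p + 2 * p\<^sup>2) * m2 \<le> (2 * p) * m2"
      using p half mult_left_mono[of p "1/2" "2 * p"] by (intro mult_right_mono) (auto simp: power2_eq_square)
    also have "\<dots> \<le> 4 * h * ln n / n" using pm2 by simp
    finally have "exp (- (4 * h * ln n / n)) \<le> exp (- ((p + 2 * p\<^sup>2) * m2))" by simp
    also have "\<dots> \<le> (1 - p) ^ m2" by (rule power_one_minus_ge_exp[OF p half])
    finally have "1 / (1 - p) ^ m2 \<le> 1 / exp (- (4 * h * ln n / n))"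
      by (intro divide_left_mono) (use half in auto)
    then show ?thesis by (simp add: exp_minus field_simps)
  qed
  ultimately show ?thesis using prob_matchable_le[of p] p half by linarith
qed

lemma prob_matchable_lower:
  fixes p b t :: real
  assumes p: "0 \<le> p" "p \<le> 1" and ev: "even n" and b: "0 < b"
  shows "1 - measure_pmf.prob (random_inclusion p) {\<omega>. matchable \<omega>}
    \<le> measure_pmf.prob (random_inclusion p) {\<omega>. \<not> all_covered \<omega>}
     + measure_pmf.prob (random_inclusion p) {\<omega>. \<not> low_separated \<omega>}
     + measure_pmf.prob (random_inclusion p) {\<omega>. \<not> locally_sparse t \<omega>}
     + measure_pmf.prob (random_inclusion p) {\<omega>. \<not> medium_expanding t b \<omega>}
     + measure_pmf.prob (random_inclusion p) {\<omega>. \<not> large_joined b \<omega>}"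
proof -
  let ?P = "random_inclusion p"
  let ?A = "{\<omega>. \<not> all_covered \<omega>}" and ?B = "{\<omega>. \<not> low_separated \<omega>}" and ?C = "{\<omega>. \<not> locally_sparse t \<omega>}"
    and ?D = "{\<omega>. \<not> medium_expanding t b \<omega>}" and ?E = "{\<omega>. \<not> large_joined b \<omega>}"
  have "1 - measure_pmf.prob ?P {\<omega>. matchable \<omega>} = measure_pmf.prob ?P (- {\<omega>. matchable \<omega>})"
    by (subst measure_pmf.prob_compl[symmetric]) (auto simp: Compl_eq_Diff_UNIV)
  also have "\<dots> \<le> measure_pmf.prob ?P (?A \<union> ?B \<union> ?C \<union> ?D \<union> ?E)"
    using has_perfect_matchingI[OF ev b] unfolding matchable_def
    by (intro measure_pmf.finite_measure_mono) auto
  also have "\<dots> \<le> measure_pmf.prob ?P ?A + measure_pmf.prob ?P ?B + measure_pmf.prob ?P ?C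
      + measure_pmf.prob ?P ?D + measure_pmf.prob ?P ?E"
    by (intro order.trans[OF measure_Un_le] add_mono order_refl) auto
  finally show ?thesis .
qed

end

section \<open>Quantitative bounds\<close>

context copy_model
begin

context
  fixes p :: real
  assumes p: "0 \<le> p" "p \<le> 1"
    and L_lower: "ln n \<le> p * m" and L_upper: "p * m \<le> 2 * ln n"
    and ln_ge_1: "1 \<le> ln n" and ln_le: "4 * h * ln n / n \<le> 1"
begin

lemma n_pos: "0 < real n"
  using n_ge_2 by simp

lemma pm_div_n_le: "2 * h * (p * m) / n \<le> 4 * h * ln n / n"
proof -
  have "2 * h * (p * m) \<le> 2 * h * (2 * ln n)" using L_upper by (intro mult_left_mono) auto
  then show ?thesis using n_pos by (simp add: divide_right_mono)
qed

lemma prob_not_low_separated_le: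
  "measure_pmf.prob (random_inclusion p) {\<omega>. \<not> low_separated \<omega>}
    \<le> 1024 * h ^ 5 * exp 9 * ln n ^ (4 + 100 * h) / n"
proof -
  \<comment> \<open>This choice balances the losses: \<open>l ^ (100 * h)\<close> costs a power of
    \<open>ln n\<close>, and \<open>l * y\<close> stays at most 4.\<close>
  define l where "l = 1 / ln n"
  define L where "L = p * m"
  define y where "y = p * (2 * real m - m2 - 4)"
  have l: "0 < l" "l \<le> 1" unfolding l_def using ln_ge_1 by auto
  have L: "1 \<le> L" "ln n \<le> L" "L \<le> 2 * ln n" "1 \<le> p * m"
    unfolding L_def using L_lower L_upper ln_ge_1 by auto
  have "p * m2 \<le> 1" using p_m2_le[OF p(1)] pm_div_n_le ln_le by linarith
  then have y: "2 * L - 5 \<le> y" unfolding y_def L_def using p by (simp add: algebra_simps)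
  have "y \<le> 2 * L" unfolding y_def L_def using p by (simp add: algebra_simps)
  then have "l * y \<le> l * (2 * (2 * ln n))" using l L by (intro mult_left_mono) auto
  also have "\<dots> = 4" unfolding l_def using ln_ge_1 by simp
  \<comment> \<open>The \<open>9\<close> is \<open>5\<close>, from the shared copies and the chain,
    plus \<open>4\<close> from \<open>l * y\<close>.\<close>
  finally have "2 * ln n - 9 \<le> (1 - l) * y" using y L by (simp add: algebra_simps)
  then have "exp (- (p * (1 - l) * (2 * real m - m2 - 4))) \<le> exp (9 - 2 * ln n)"
    unfolding y_def by (simp add: mult_ac)
  also have "\<dots> = exp 9 / real n ^ 2"
    using n_pos exp_of_nat_mult[of 2 "ln (real n)"] by (simp add: exp_diff)
  finally have e: "exp (- (p * (1 - l) * (2 * real m - m2 - 4))) \<le> exp 9 / real n ^ 2" .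
  have "measure_pmf.prob (random_inclusion p) {\<omega>. \<not> low_separated \<omega>}
    \<le> 64 * h ^ 2 * (n * L) * (h * L) ^ 3 * (exp (- (p * (1 - l) * (2 * real m - m2 - 4))) / l ^ (100 * h))"
    using prob_not_low_separated[OF p l L(4)] unfolding L_def .
  also have "\<dots> \<le> 64 * h ^ 2 * (n * (2 * ln n)) * (h * (2 * ln n)) ^ 3 * (exp 9 / real n ^ 2 / l ^ (100 * h))"
    using L e l ln_ge_1
    by (intro mult_mono mult_left_mono divide_right_mono power_mono) (auto intro!: mult_nonneg_nonneg)
  \<comment> \<open>Four factors \<open>p * m\<close>, each at most \<open>2 * ln n\<close>, turn
    \<open>64\<close> into \<open>1024\<close>.\<close>
  also have "\<dots> = 1024 * h ^ 5 * exp 9 * ln n ^ (4 + 100 * h) / n"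
    unfolding l_def using n_pos
    by (simp add: power_add power_mult_distrib power_divide field_simps power2_eq_square power3_eq_cube eval_nat_numeral)
  finally show ?thesis .
qed

text \<open>
  Any exponent strictly between \<open>1/2\<close> and \<open>1\<close> would do in place of \<open>6/10\<close>: local sparsity needs it
  below \<open>1\<close>, and the union bound over pairs \<open>(S, T)\<close> needs it above \<open>1/2\<close>.
\<close>

lemma prob_not_locally_sparse_le:
  assumes small: "20 * h * ln n * n powr (-1/10) \<le> 1"
  shows "measure_pmf.prob (random_inclusion p) {\<omega>. \<not> locally_sparse (n powr (6/10)) \<omega>} \<le> exp 1 / n"
proof -
  \<comment> \<open>Then \<open>l ^ 10 = n ^ 3\<close> beats the two factors \<open>n\<close> of the
    union bound, while \<open>l * n powr (6/10)\<close> falls short of \<open>n\<close> by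
    \<open>n powr (1/10)\<close>, enough to absorb the logarithm.\<close>
  define l where "l = real n powr (3/10)"
  have l1: "1 \<le> l" unfolding l_def using n_ge_2 by (intro ge_one_powr_ge_zero) auto
  have l10: "l ^ 10 = real n ^ 3"
    unfolding l_def using n_pos by (simp add: powr_power powr_numeral)
  have "p * l * (5 * n powr (6/10)) * m2 = 5 * (p * m2) * (l * n powr (6/10))" by simp
  also have "\<dots> \<le> 5 * (4 * h * ln n / n) * (l * n powr (6/10))"
    using p_m2_le[OF p(1)] pm_div_n_le l1 by (intro mult_left_mono mult_right_mono) auto
  also have "\<dots> = 20 * h * ln n * n powr (-1/10)"
  proof -
    have "l * n powr (6/10) = n powr (9/10)" unfolding l_def by (simp add: powr_add[symmetric])
    moreover have "n powr (9/10) = n powr (-1/10) * n"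
    proof -
      have "n powr (-1/10) * n = n powr (-1/10) * n powr 1" using n_pos by simp
      then show ?thesis unfolding powr_add[symmetric] by simp
    qed
    ultimately show ?thesis using n_pos by simp
  qed
  also note small
  finally have a: "p * l * (5 * n powr (6/10)) * m2 \<le> 1" .
  have "n * exp 1 \<le> real n * 4" using exp_le by (intro mult_left_mono) auto
  also have "real n * 4 \<le> real n * (real n * real n)"
    using n_ge_2 mult_mono[of 2 "real n" 2 "real n"] by (intro mult_left_mono) auto
  finally have b: "n * exp 1 / l ^ 10 \<le> 1" unfolding l10 using n_pos by (simp add: power3_eq_cube)
  have "measure_pmf.prob (random_inclusion p) {\<omega>. \<not> locally_sparse (n powr (6/10)) \<omega>} \<le> n * (n * exp 1 / l ^ 10)"
    by (rule prob_not_locally_sparse[OF p l1 a b])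
  also have "\<dots> = exp 1 / n" unfolding l10 using n_pos by (simp add: field_simps eval_nat_numeral)
  finally show ?thesis .
qed

text \<open>Per vertex of \<open>S\<close> the two binomials cost
  \<open>exp 2 * n powr (8/10)\<close>, since \<open>s > n powr (6/10)\<close>, and the exponential
  gains \<open>n powr (-95/100)\<close>. The constant \<open>240\<close> makes the largest size
  \<open>n / (80 * h)\<close>, for which at most a twentieth of \<open>p * m\<close> is
  lost.\<close>

lemma prob_not_medium_expanding_le:
  assumes t: "20 \<le> n powr (6/10)" and small: "exp 2 * n powr (-15/100) \<le> 1"
  shows "measure_pmf.prob (random_inclusion p) {\<omega>. \<not> medium_expanding (n powr (6/10)) (n / (240 * h)) \<omega>}
    \<le> exp 40 / n ^ 2"
proof -
  let ?J = "{s. s \<in> {1..n} \<and> n powr (6/10) < real s \<and> real s \<le> 3 * (n / (240 * h))}"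
  define r where "r = exp 2 * n powr (-15/100)"
  have r: "0 \<le> r" "r \<le> 1" unfolding r_def using small by auto
  have h: "real h > 0" using h_ge_2 by simp
  have "measure_pmf.prob (random_inclusion p) {\<omega>. \<not> medium_expanding (n powr (6/10)) (n / (240 * h)) \<omega>}
    \<le> (\<Sum>s\<in>?J. (real (n choose s))\<^sup>2 * exp (- (p * (s * (real m - 2 * s * m2)))))"
    using prob_not_medium_expanding[OF p, of "n powr (6/10)" "n / (240 * h)"] by simp
  also have "\<dots> \<le> (\<Sum>s\<in>?J. r ^ 20)"
  proof (rule sum_mono)
    fix s assume "s \<in> ?J"
    then have s: "0 < s" "s \<le> n" "n powr (6/10) < real s" "real s \<le> 3 * (n / (240 * h))" by auto
    \<comment> \<open>Twenty factors give \<open>n powr (-3)\<close>, as 20 * 15/100 = 3; this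
      outweighs the number of sizes.\<close>
    have s20: "20 \<le> s" using s(3) t by linarith
    have "exp 1 * n / s \<le> exp 1 * n / n powr (6/10)"
      using s n_pos by (intro divide_left_mono) auto
    also have "\<dots> = exp 1 * n powr (4/10)"
    proof -
      have "n powr (4/10) = n / n powr (6/10)" using powr_diff[of "real n" 1 "6/10"] n_pos by simp
      then show ?thesis by (simp only: times_divide_eq_right)
    qed
    finally have "(exp 1 * n / s) ^ s \<le> (exp 1 * n powr (4/10)) ^ s" by (intro power_mono) auto
    then have "real (n choose s) \<le> (exp 1 * n powr (4/10)) ^ s"
      using binomial_le_exp_power[OF s(1,2)] by linarith
    then have "(real (n choose s))\<^sup>2 \<le> ((exp 1 * n powr (4/10)) ^ s)\<^sup>2" by (intro power_mono) auto
    also have "\<dots> = ((exp 1 * n powr (4/10))\<^sup>2) ^ s" by (simp only: power_mult[symmetric] mult.commute)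
    also have "(exp 1 * n powr (4/10))\<^sup>2 = exp 2 * n powr (8/10)"
    proof -
      have "(n powr (4/10))\<^sup>2 = n powr (8/10)"
        unfolding power2_eq_square powr_add[symmetric] by simp
      moreover have "(exp 1 :: real)\<^sup>2 = exp 2"
        unfolding power2_eq_square exp_add[symmetric] by simp
      ultimately show ?thesis unfolding power_mult_distrib by (simp only:)
    qed
    finally have bin: "(real (n choose s))\<^sup>2 \<le> (exp 2 * n powr (8/10)) ^ s" .
    have "(95/100) * ln n \<le> p * (real m - 2 * s * m2)"
    proof -
      have "real s * (2 * h * (p * m) / n) \<le> 3 * (n / (240 * h)) * (2 * h * (p * m) / n)"
        using s(4) p by (intro mult_right_mono) auto
      also have "\<dots> = (p * m) / 40" using h n_pos by (simp add: field_simps)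
      finally have "2 * s * (p * m2) \<le> (p * m) / 20"
        using mult_left_mono[OF p_m2_le[OF p(1)], of "real s"] by simp
      then have "(19/20) * (p * m) \<le> p * (real m - 2 * s * m2)" by (simp add: algebra_simps)
      then show ?thesis using L_lower by linarith
    qed
    then have "s * ((95/100) * ln n) \<le> s * (p * (real m - 2 * s * m2))" by (intro mult_left_mono) auto
    then have "exp (- (p * (s * (real m - 2 * s * m2)))) \<le> exp (s * (- (95/100) * ln n))"
      by (simp add: mult_ac)
    also have "\<dots> = (n powr (-95/100)) ^ s"
      using n_pos by (subst exp_of_nat_mult) (simp add: powr_def)
    finally have ex: "exp (- (p * (s * (real m - 2 * s * m2)))) \<le> (n powr (-95/100)) ^ s" .
    have "(real (n choose s))\<^sup>2 * exp (- (p * (s * (real m - 2 * s * m2))))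
        \<le> (exp 2 * n powr (8/10)) ^ s * (n powr (-95/100)) ^ s"
      using bin ex by (intro mult_mono) auto
    also have "\<dots> = r ^ s"
    proof -
      have "n powr (8/10) * n powr (-95/100) = n powr (-15/100)" unfolding powr_add[symmetric] by simp
      then show ?thesis unfolding r_def power_mult_distrib[symmetric] by (simp add: mult.assoc)
    qed
    also have "\<dots> \<le> r ^ 20" using r s20 by (intro power_decreasing) auto
    finally show "(real (n choose s))\<^sup>2 * exp (- (p * (s * (real m - 2 * s * m2)))) \<le> r ^ 20" .
  qed
  also have "\<dots> \<le> n * r ^ 20"
  proof -
    have "card ?J \<le> card {1..n}" by (intro card_mono) auto
    then show ?thesis using r by (simp add: mult_right_mono)
  qed
  also have "r ^ 20 = exp 40 / n ^ 3"
  proof -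
    have "(n powr (-15/100)) ^ 20 = n powr (-3)" 
      using n_pos powr_powr[of "real n" "-15/100" 20] by (simp add: powr_numeral)
    also have "\<dots> = 1 / n ^ 3" using n_pos by (simp add: powr_minus powr_numeral divide_inverse)
    finally have "(n powr (-15/100)) ^ 20 = 1 / n ^ 3" .
    moreover have "(exp 2 :: real) ^ 20 = exp 40" using exp_of_nat_mult[of 20 "2 :: real"] by simp
    ultimately show ?thesis unfolding r_def power_mult_distrib by simp
  qed
  also have "n * (exp 40 / n ^ 3) = exp 40 / n ^ 2"
    using n_pos by (simp add: field_simps eval_nat_numeral)
  finally show ?thesis .
qed

text \<open>\<open>57600\<close> is the square of \<open>240\<close>. For large \<open>n\<close> the
  \<open>ln n\<close> term overwhelms \<open>ln 4\<close>, the cost of choosing the two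
  sets.\<close>

lemma prob_not_large_joined_le:
  "measure_pmf.prob (random_inclusion p) {\<omega>. \<not> large_joined (n / (240 * h)) \<omega>}
    \<le> exp (n * (ln 4 - 1 / (57600 * h ^ 4) * ln n))"
proof -
  have h: "real h > 0" using h_ge_2 by simp
  have "measure_pmf.prob (random_inclusion p) {\<omega>. \<not> large_joined (n / (240 * h)) \<omega>}
      \<le> 4 ^ n * exp (- (p * ((n / (240 * h))\<^sup>2 * m / (n * h ^ 2))))"
    by (rule prob_not_large_joined[OF p]) simp
  also have "p * ((n / (240 * h))\<^sup>2 * m / (n * h ^ 2)) = (p * m) * (n / (57600 * h ^ 4))"
    using n_pos h by (simp add: field_simps power2_eq_square power4_eq_xxxx)
  also have "exp (- ((p * m) * (n / (57600 * h ^ 4)))) \<le> exp (- (ln n * (n / (57600 * h ^ 4))))"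
  proof -
    have "ln n * (n / (57600 * h ^ 4)) \<le> (p * m) * (n / (57600 * h ^ 4))"
      using L_lower by (intro mult_right_mono) auto
    then show ?thesis by (simp only: exp_le_cancel_iff neg_le_iff_le)
  qed
  also have "(4::real) ^ n = exp (n * ln 4)" by (simp add: exp_of_nat_mult)
  finally show ?thesis by (simp add: exp_add[symmetric] algebra_simps)
qed

lemma prob_matchable_ge:
  assumes "even n" "20 * h * ln n * n powr (-1/10) \<le> 1" "20 \<le> n powr (6/10)"
    "exp 2 * n powr (-15/100) \<le> 1"
  shows "1 - measure_pmf.prob (random_inclusion p) {\<omega>. matchable \<omega>}
    \<le> exp (ln n - p * m) + 1024 * h ^ 5 * exp 9 * ln n ^ (4 + 100 * h) / n
      + exp 1 / n + exp 40 / n ^ 2 + exp (n * (ln 4 - 1 / (57600 * h ^ 4) * ln n))"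
proof -
  have b: "0 < n / (240 * h)" using n_pos h_ge_2 by simp
  have "n * exp (- (p * m)) = exp (ln n - p * m)" using n_pos by (simp add: exp_diff exp_minus field_simps)
  then have "measure_pmf.prob (random_inclusion p) {\<omega>. \<not> all_covered \<omega>} \<le> exp (ln n - p * m)"
    using prob_not_covered[OF p] by simp
  with prob_matchable_lower[OF p assms(1) b, of "n powr (6/10)"] prob_not_low_separated_le
    prob_not_locally_sparse_le[OF assms(2)] prob_not_medium_expanding_le[OF assms(3,4)]
    prob_not_large_joined_le
  show ?thesis by linarith
qed

end

end

section \<open>The threshold\<close>

lemma eventually_even_at_top:
  "eventually P sequentially \<Longrightarrow> eventually (\<lambda>n. even n \<and> P n) even_at_top"
  unfolding even_at_top_def eventually_inf_principal by (auto elim: eventually_mono)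

lemma tendsto_even_at_top:
  "(f \<longlongrightarrow> c) sequentially \<Longrightarrow> (f \<longlongrightarrow> c) even_at_top"
  unfolding even_at_top_def by (rule tendsto_mono[OF inf_le1])

lemma delta_1:
  assumes "simple_graph H" "verts H \<noteq> {}" "no_isolated_vertices H"
  shows "delta 1 H = 0"
proof -
  have fin: "finite (verts H)" using assms by (simp add: simple_graph_def)
  have "1 \<le> vertex_degree H v" if v: "v \<in> verts H" for v
  proof -
    have "finite (edges H)"
      using assms(1) fin by (intro finite_subset[of "edges H" "Pow (verts H)"]) (auto simp: simple_graph_def)
    moreover have "{e \<in> edges H. v \<in> e} \<noteq> {}"
      using assms(3) v unfolding no_isolated_vertices_def by blast
    ultimately show ?thesis unfolding vertex_degree_def by (simp add: Suc_le_eq card_gt_0_iff)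
  qed
  then have "1 \<le> min_degree H" unfolding min_degree_def using fin assms(2) by simp
  then have "\<lceil>real 1 / real (min_degree H)\<rceil> = 1" by (intro ceiling_unique) auto
  then show ?thesis by (simp add: delta_def)
qed

text \<open>The functions \<open>p_minus 1\<close> and \<open>p_plus 1\<close> have no \<open>ln ln n\<close> term, as \<open>\<delta>\<^sub>1(H) = 0\<close>.\<close>

theorem theorem4:
  fixes H :: "'a ugraph" and x p :: "nat \<Rightarrow> real"
  assumes "simple_graph H" and "verts H \<noteq> {}" and "no_isolated_vertices H"
    and "filterlim x at_top sequentially"
    and "x \<in> o(\<lambda>n. ln (ln (real n)))"
    and "\<forall>n. 0 \<le> p n \<and> p n \<le> 1"
  shows "((\<forall>\<^sub>F n in even_at_top. p n \<le> p_minus 1 H x n) \<longrightarrow>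
           ((\<lambda>n. measure_pmf.prob (random_copies_graph H n (p n)) {G. has_perfect_matching G})
              \<longlongrightarrow> 0) even_at_top)
       \<and> ((\<forall>\<^sub>F n in even_at_top. p n \<ge> p_plus 1 H x n) \<longrightarrow>
           ((\<lambda>n. measure_pmf.prob (random_copies_graph H n (p n)) {G. has_perfect_matching G})
              \<longlongrightarrow> 1) even_at_top)"
proof (intro conjI impI)
  define k where "k = card (verts H)"
  have k: "real k > 0" unfolding k_def using assms(1,2) by (simp add: simple_graph_def card_gt_0_iff)
  let ?pr = "\<lambda>n. measure_pmf.prob (random_copies_graph H n (p n)) {G. has_perfect_matching G}"
  \<comment> \<open>The counting model requires room for a copy, which holds for all large
    \<open>n\<close>.\<close>
  have model: "copy_model H n" if "k \<le> n" for n
    using assms(1-3) that unfolding k_def by unfold_locales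
  have pr: "?pr n = measure_pmf.prob (copy_model.random_inclusion H n (p n)) {\<omega>. copy_model.matchable H n \<omega>}"
    if "k \<le> n" for n
    unfolding copy_model.prob_random_copies_graph[OF model[OF that]] copy_model.matchable_def[OF model[OF that]] ..
  have p01: "0 \<le> p n" "p n \<le> 1" for n using assms(6) by auto
  have x0: "\<forall>\<^sub>F n in sequentially. 0 \<le> x n" using assms(4) by (simp add: filterlim_at_top)
  \<comment> \<open>Ensures that \<open>p_plus\<close> times \<open>m\<close> is at most
    \<open>2 * ln n\<close>, the upper limit of the quantitative bounds.\<close>
  have x1: "\<forall>\<^sub>F n in sequentially. x n \<le> ln (real n)"
  proof -
    have "\<forall>\<^sub>F n in sequentially. norm (x n) \<le> 1 * norm (ln (ln (real n)))"
      using assms(5) by (rule landau_o.smallD) simp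
    moreover have "\<forall>\<^sub>F n in sequentially. \<bar>ln (ln (real n))\<bar> \<le> ln (real n)" by real_asymp
    ultimately show ?thesis by eventually_elim simp
  qed
  have large: "\<forall>\<^sub>F n in sequentially. k \<le> n" by (rule eventually_ge_at_top)
  have ln_le: "\<forall>\<^sub>F n in sequentially. 4 * k * ln (real n) / real n \<le> 1" using k by real_asymp
  have exp_x: "(\<lambda>n. exp (- x n)) \<longlonglongrightarrow> 0"
    using assms(4) by (intro filterlim_compose[OF exp_at_bot]) (simp add: filterlim_uminus_at_bot)
  {
    assume small: "\<forall>\<^sub>F n in even_at_top. p n \<le> p_minus 1 H x n"
    define B where "B = (\<lambda>n. exp (- x n) * exp (4 * k * (ln (real n))\<^sup>2 / real n) + (exp (4 * k * ln (real n) / real n) - 1))"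
    have le: "\<forall>\<^sub>F n in even_at_top. ?pr n \<le> B n"
      using small eventually_even_at_top[OF x0] eventually_even_at_top[OF large] eventually_even_at_top[OF ln_le]
    proof eventually_elim
      case (elim n)
      interpret copy_model H n using model elim by blast
      have hk: "h = k" unfolding k_def h_def ..
      have "p n * m \<le> ln n - x n"
        using elim(1) m_pos delta_1[OF assms(1-3)] unfolding p_minus_def m_def by (simp add: field_simps)
      then have "?pr n \<le> exp (- x n + 4 * k * (ln n)\<^sup>2 / n) + exp (4 * k * ln n / n) - 1"
        using prob_matchable_upper[of "p n" "x n"] p01 elim unfolding pr[OF conjunct2[OF elim(3)]] hk by simp
      then show ?case unfolding B_def by (simp add: exp_add[symmetric])
    qed
    have "B \<longlonglongrightarrow> 0"
    proof -
      have "(\<lambda>n. exp (4 * k * (ln (real n))\<^sup>2 / real n)) \<longlonglongrightarrow> 1"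
        "(\<lambda>n. exp (4 * k * ln (real n) / real n) - 1) \<longlonglongrightarrow> 0" using k by real_asymp+
      then have "B \<longlonglongrightarrow> 0 * 1 + 0" unfolding B_def using exp_x by (intro tendsto_intros)
      then show ?thesis by simp
    qed
    note lim = tendsto_even_at_top[OF this]
    show "(?pr \<longlongrightarrow> 0) even_at_top"
      by (rule tendsto_sandwich[OF _ le tendsto_const lim]) simp
  }
  {
    assume big: "\<forall>\<^sub>F n in even_at_top. p_plus 1 H x n \<le> p n"
    define B where "B = (\<lambda>n. exp (- x n) + 1024 * k ^ 5 * exp 9 * ln (real n) ^ (4 + 100 * k) / real n
      + exp 1 / real n + exp 40 / real n ^ 2 + exp (real n * (ln 4 - 1 / (57600 * k ^ 4) * ln (real n))))"
    have ev: "\<forall>\<^sub>F n in sequentially. 1 \<le> ln (real n)"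
      "\<forall>\<^sub>F n in sequentially. 20 * k * ln (real n) * real n powr (-1/10) \<le> 1"
      "\<forall>\<^sub>F n in sequentially. 20 \<le> real n powr (6/10)"
      "\<forall>\<^sub>F n in sequentially. exp 2 * real n powr (-15/100) \<le> 1"
      using k by real_asymp+
    have ge: "\<forall>\<^sub>F n in even_at_top. 1 - B n \<le> ?pr n"
      using big eventually_even_at_top[OF x0] eventually_even_at_top[OF x1] eventually_even_at_top[OF large]
        eventually_even_at_top[OF ln_le] eventually_even_at_top[OF ev(1)] eventually_even_at_top[OF ev(2)]
        eventually_even_at_top[OF ev(3)] eventually_even_at_top[OF ev(4)]
    proof eventually_elim
      case (elim n)
      interpret copy_model H n using model elim by blast
      have hk: "h = k" unfolding k_def h_def ..
      \<comment> \<open>The quantitative bounds need an upper limit on the inclusion probability,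
        which \<open>p n\<close> may exceed. That \<open>q\<close> is at most 1 follows from
        \<open>q \<le> p n\<close>.\<close>
      define q where "q = p_plus 1 H x n"
      have qm: "q * m = ln n + x n"
        using m_pos delta_1[OF assms(1-3)] unfolding q_def p_plus_def m_def by simp
      have "0 \<le> q * m" using qm elim by simp
      then have q: "0 \<le> q" "q \<le> p n" "q \<le> 1"
        using m_pos elim(1) p01(2)[of n] unfolding q_def by (auto simp: zero_le_mult_iff)
      have "1 - measure_pmf.prob (random_inclusion q) {\<omega>. matchable \<omega>} \<le> B n"
        using prob_matchable_ge[of q] q qm elim unfolding hk B_def by simp
      moreover have "measure_pmf.prob (random_inclusion q) {\<omega>. matchable \<omega>} \<le> ?pr n"
        unfolding pr[OF conjunct2[OF elim(4)]] using prob_matchable_mono[OF q(1,2) p01(2)] .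
      ultimately show ?case by linarith
    qed
    have "(\<lambda>n. 1 - B n) \<longlonglongrightarrow> 1"
    proof -
      have "(\<lambda>n. 1024 * k ^ 5 * exp 9 * ln (real n) ^ (4 + 100 * k) / real n
          + exp 1 / real n + exp 40 / real n ^ 2 + exp (real n * (ln 4 - 1 / (57600 * k ^ 4) * ln (real n)))) \<longlonglongrightarrow> 0"
        using k by real_asymp
      from tendsto_diff[OF tendsto_const[of 1] tendsto_add[OF exp_x this]]
      show ?thesis unfolding B_def by (simp add: add.assoc)
    qed
    note lim = tendsto_even_at_top[OF this]
    show "(?pr \<longlongrightarrow> 1) even_at_top"
      by (rule tendsto_sandwich[OF ge _ lim tendsto_const]) simp
  }
qed

end
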